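(* Let $R>0$, $\alpha\in\mathbb{R}$ and let $m\ge 0$ be an integer. The space $\mathcal{A}^{2,\alpha}_{R,m}(\mathbb{D}_R)$ is nontrivial (i.e. contains a nonzero function) if and only if $\alpha>-1$. In this case ($\alpha>-1$), $\mathcal{A}^{2,\alpha}_{R,m}(\mathbb{D}_R)$, equipped with the scalar product $\langle\cdot,\cdot\rangle_{\alpha,m,R}$, is a reproducing kernel Hilbert space, and its reproducing kernel is given, for $z,w\in\mathbb{D}_R$, by $$K^{\alpha}_{R,m}(z,w)=\frac{\alpha+1}{\pi R^{2}}\left\{\sum_{n=0}^{m-1}\frac{\Gamma(\alpha+2+n)}{\Gamma(n+1)\Gamma(\alpha+2)}\left(\frac{z\overline{w}}{R^{2}}\right)^{n}+\frac{(z\overline{w})^{m}}{(m!)^2}\;{}_3F_2\left(\begin{array}{c}1,1,\alpha+2\\ m+1,m+1\end{array}\bigg|\frac{z\overline{w}}{R^{2}}\right)\right\}.$$ Moreover, a function $f(z)=\sum_{n=0}^{+\infty}a_nz^n$ on $\mathbb{D}_R$ (a power series convergent on $\mathbb{D}_R$) belongs to $\mathcal{A}^{2,\alpha}_{R,m}(\mathbb{D}_R)$ if and only if $$\|f\|_{\alpha,m,R}^{2}=\pi\left\{\sum_{n=0}^{m-1}\frac{n!\,\Gamma(\alpha+1)R^{2n+2}}{\Gamma(n+\alpha+2)}|a_n|^2+\sum_{n=m}^{\infty}\frac{(n!)^2\,\Gamma(\alpha+1)R^{2(n-m)+2}}{(n-m)!\,\Gamma(n-m+\alpha+2)}|a_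n|^2\right\}<+\infty.$$
   Context: $\mathbb{D}_R=\{z\in\mathbb{C}:|z|<R\}$, and $d\lambda$ is the two-dimensional Lebesgue measure on $\mathbb{C}$. For $\alpha\in\mathbb{R}$ put $d\mu_{\alpha,R}(z)=\left(1-\left|\frac{z}{R}\right|^2\right)^{\alpha}d\lambda(z)$ on $\mathbb{D}_R$, $\langle f,g\rangle_{\alpha,R}=\int_{\mathbb{D}_R}f\overline{g}\,d\mu_{\alpha,R}$ and $\|f\|_{\alpha,R}^2=\int_{\mathbb{D}_R}|f|^2d\mu_{\alpha,R}\in[0,+\infty]$. $\mathcal{H}ol(\mathbb{D}_R)$ is the space of power series $f(z)=\sum_{n\ge0}a_nz^n$ convergent on $\mathbb{D}_R$ (holomorphic functions). For such $f$ and an integer $m\ge0$, write $f=f_{1,m}+f_{2,m}$ with $f_{1,m}(z)=\sum_{n=0}^{m-1}a_nz^n$ (with $f_{1,0}=0$) and $f_{2,m}(z)=\sum_{n=m}^{\infty}a_nz^n$. The space $\mathcal{A}^{2,\alpha}_{R,m}(\mathbb{D}_R)$ consists of all $f\in\mathcal{H}ol(\mathbb{D}_R)$ with $$\|f\|_{\alpha,m,R}^2:=\|f_{1,m}\|_{\alpha,R}^2+\|f_{2,m}^{(m)}\|_{\alpha,R}^2<+\infty,$$ where $f^{(m)}$ denotes the $m$-th complex derivative. Its scalar product is $\langle f,g\rangle_{\alpha,m,R}=\langle f_{1,m},g_{1,m}\rangle_{\alpha,R}+\langle f_{2,m}^{(m)},g_{2,m}^{(m)}\rangle_{\alpha,R}$.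 The hypergeometric function is ${}_3F_2\left(\begin{array}{c} a,b,c \\ a',b' \end{array}\bigg|x\right)=\sum_{k\ge0}\frac{(a)_k(b)_k(c)_k}{(a')_k(b')_k}\frac{x^k}{k!}$ for $|x|<1$, with $(a)_k=a(a+1)\cdots(a+k-1)$, $(a)_0=1$. Empty sums are $0$. *)

theory Defs
  imports "HOL-Complex_Analysis.Complex_Analysis"
begin

section \<open>Hilbert spaces of functions and reproducing kernels\<close>

text \<open>
  A complex Hilbert space of functions on \<open>X\<close> with pointwise operations.  Functions on \<open>X\<close> are
  represented by total functions that vanish off \<open>X\<close>, so that equality of elements of \<open>H\<close> is
  equality on \<open>X\<close>.
\<close>

locale function_hilbert_space =
  fixes X :: "'a set" and H :: "('a \<Rightarrow> complex) set"
    and ip :: "('a \<Rightarrow> complex) \<Rightarrow> ('a \<Rightarrow> complex) \<Rightarrow> complex"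
  assumes vanish: "f \<in> H \<Longrightarrow> x \<notin> X \<Longrightarrow> f x = 0"
    and zero_mem: "(\<lambda>x. 0) \<in> H"
    and add_mem: "f \<in> H \<Longrightarrow> g \<in> H \<Longrightarrow> (\<lambda>x. f x + g x) \<in> H"
    and scale_mem: "f \<in> H \<Longrightarrow> (\<lambda>x. c * f x) \<in> H"
    and ip_add_left: "f \<in> H \<Longrightarrow> g \<in> H \<Longrightarrow> h \<in> H \<Longrightarrow> ip (\<lambda>x. f x + g x) h = ip f h + ip g h"
    and ip_scale_left: "f \<in> H \<Longrightarrow> g \<in> H \<Longrightarrow> ip (\<lambda>x. c * f x) g = c * ip f g"
    and ip_commute: "f \<in> H \<Longrightarrow> g \<in> H \<Longrightarrow> ip g f = cnj (ip f g)"
    and ip_nonneg: "f \<in> H \<Longrightarrow> ip f f \<in> \<real> \<and> 0 \<le> Re (ip f f)"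
    and ip_definite: "f \<in> H \<Longrightarrow> ip f f = 0 \<Longrightarrow> f = (\<lambda>x. 0)"
    and complete: "\<lbrakk>\<And>n. F n \<in> H;
        \<And>e. e > 0 \<Longrightarrow> \<exists>N. \<forall>i\<ge>N. \<forall>j\<ge>N.
          sqrt (Re (ip (\<lambda>x. F i x - F j x) (\<lambda>x. F i x - F j x))) < e\<rbrakk>
      \<Longrightarrow> \<exists>f\<in>H. (\<lambda>n. sqrt (Re (ip (\<lambda>x. F n x - f x) (\<lambda>x. F n x - f x)))) \<longlonglongrightarrow> 0"

locale reproducing_kernel_hilbert_space = function_hilbert_space +
  assumes evaluation_bounded: "x \<in> X \<Longrightarrow> \<exists>C. \<forall>f\<in>H. cmod (f x) \<le> C * sqrt (Re (ip f f))"

definition restrict_zero :: "'a set \<Rightarrow> ('a \<Rightarrow> complex) \<Rightarrow> 'a \<Rightarrow> complex" where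
  "restrict_zero X f = (\<lambda>x. if x \<in> X then f x else 0)"

definition reproducing_kernel ::
  "'a set \<Rightarrow> ('a \<Rightarrow> complex) set \<Rightarrow> (('a \<Rightarrow> complex) \<Rightarrow> ('a \<Rightarrow> complex) \<Rightarrow> complex)
    \<Rightarrow> ('a \<Rightarrow> 'a \<Rightarrow> complex) \<Rightarrow> bool" where
  "reproducing_kernel X H ip K \<longleftrightarrow>
    (\<forall>w\<in>X. restrict_zero X (\<lambda>z. K z w) \<in> H \<and>
       (\<forall>f\<in>H. f w = ip f (restrict_zero X (\<lambda>z. K z w))))"


section \<open>The weighted spaces on the disc of radius \<open>R\<close>\<close>

definition disc_measure :: "real \<Rightarrow> real \<Rightarrow> complex measure" where
  "disc_measure R \<alpha> = density (restrict_space lborel (ball 0 R))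
     (\<lambda>z. ennreal ((1 - (cmod (z / of_real R))\<^sup>2) powr \<alpha>))"

definition disc_ip :: "real \<Rightarrow> real \<Rightarrow> (complex \<Rightarrow> complex) \<Rightarrow> (complex \<Rightarrow> complex) \<Rightarrow> complex" where
  "disc_ip R \<alpha> f g = (\<integral>z. f z * cnj (g z) \<partial>disc_measure R \<alpha>)"

definition disc_norm2 :: "real \<Rightarrow> real \<Rightarrow> (complex \<Rightarrow> complex) \<Rightarrow> ennreal" where
  "disc_norm2 R \<alpha> f = (\<integral>\<^sup>+z. ennreal ((cmod (f z))\<^sup>2) \<partial>disc_measure R \<alpha>)"

definition Hol :: "real \<Rightarrow> (complex \<Rightarrow> complex) set" where
  "Hol R = {f. f holomorphic_on ball 0 R \<and> (\<forall>z. z \<notin> ball 0 R \<longrightarrow> f z = 0)}"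

definition part1 :: "nat \<Rightarrow> (complex \<Rightarrow> complex) \<Rightarrow> complex \<Rightarrow> complex" where
  "part1 m f z = (\<Sum>n<m. fps_nth (fps_expansion f 0) n * z ^ n)"

text \<open>
  The series below need only converge for \<open>z\<close> in the disc.  Its values elsewhere are irrelevant:
  \<open>part2 m f\<close> is only differentiated and integrated on the open disc.
\<close>

definition part2 :: "nat \<Rightarrow> (complex \<Rightarrow> complex) \<Rightarrow> complex \<Rightarrow> complex" where
  "part2 m f z = (\<Sum>k. fps_nth (fps_expansion f 0) (k + m) * z ^ (k + m))"

definition bergman_norm2 :: "real \<Rightarrow> real \<Rightarrow> nat \<Rightarrow> (complex \<Rightarrow> complex) \<Rightarrow> ennreal" where
  "bergman_norm2 R \<alpha> m f =
     disc_norm2 R \<alpha> (part1 m f) + disc_norm2 R \<alpha> ((deriv ^^ m) (part2 m f))"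

definition bergman_ip ::
  "real \<Rightarrow> real \<Rightarrow> nat \<Rightarrow> (complex \<Rightarrow> complex) \<Rightarrow> (complex \<Rightarrow> complex) \<Rightarrow> complex" where
  "bergman_ip R \<alpha> m f g =
     disc_ip R \<alpha> (part1 m f) (part1 m g)
     + disc_ip R \<alpha> ((deriv ^^ m) (part2 m f)) ((deriv ^^ m) (part2 m g))"

definition bergman_space :: "real \<Rightarrow> real \<Rightarrow> nat \<Rightarrow> (complex \<Rightarrow> complex) set" where
  "bergman_space R \<alpha> m = {f \<in> Hol R. bergman_norm2 R \<alpha> m f < \<infinity>}"

text \<open>
  The third argument of \<^const>\<open>fps_hypergeo\<close> is a scaling of the variable, hence the \<open>1\<close>.
\<close>

definition hypergeometric_3F2 ::
  "complex \<Rightarrow> complex \<Rightarrow> complex \<Rightarrow> complex \<Rightarrow> complex \<Rightarrow> complex \<Rightarrow> complex" where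
  "hypergeometric_3F2 a b c a' b' x = eval_fps (fps_hypergeo [a, b, c] [a', b'] 1) x"

definition bergman_kernel :: "real \<Rightarrow> real \<Rightarrow> nat \<Rightarrow> complex \<Rightarrow> complex \<Rightarrow> complex" where
  "bergman_kernel R \<alpha> m z w =
     of_real ((\<alpha> + 1) / (pi * R\<^sup>2)) *
     ((\<Sum>n<m. of_real (Gamma (\<alpha> + 2 + real n) / (Gamma (real n + 1) * Gamma (\<alpha> + 2)))
              * (z * cnj w / of_real (R\<^sup>2)) ^ n)
      + (z * cnj w) ^ m / (fact m)\<^sup>2
        * hypergeometric_3F2 1 1 (of_real \<alpha> + 2) (of_nat m + 1) (of_nat m + 1)
            (z * cnj w / of_real (R\<^sup>2)))"

text \<open>
  The value in $[0,\infty]$ of the norm formula for the coefficient sequence \<open>a\<close>; the sum over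
  $n \ge m$ is indexed by $k = n - m$.
\<close>

definition coeff_norm2 :: "real \<Rightarrow> real \<Rightarrow> nat \<Rightarrow> (nat \<Rightarrow> complex) \<Rightarrow> ennreal" where
  "coeff_norm2 R \<alpha> m a =
     ennreal pi *
     ((\<Sum>n<m. ennreal (fact n * Gamma (\<alpha> + 1) * R ^ (2 * n + 2) / Gamma (real n + \<alpha> + 2)
                        * (cmod (a n))\<^sup>2))
      + (\<Sum>k. ennreal ((fact (k + m))\<^sup>2 * Gamma (\<alpha> + 1) * R ^ (2 * k + 2)
                        / (fact k * Gamma (real k + \<alpha> + 2)) * (cmod (a (k + m)))\<^sup>2)))"

end

theory Submission
  imports Defs "HOL-Real_Asymp.Real_Asymp"
begin

text \<open>
  Rotation invariance of Lebesgue measure makes the monomials orthogonal for every radial weight, so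
  the weighted norm of a power series is a weighted sum of the squared moduli of its coefficients, in
  $[0,\infty]$.  The squared norms of the monomials are Beta integrals, which are infinite exactly for
  \<open>\<alpha> \<le> -1\<close>.  For \<open>\<alpha> > -1\<close> the space is therefore a weighted sequence space of Taylor coefficients
  with weights \<open>W n\<close>, complete and with kernel $\sum_n (z \bar w)^n / W_n$, because that series
  converges on the disc.
\<close>

section \<open>Rotation invariance and radial integrals\<close>

text \<open>For \<alpha> < 0 the weight is unbounded at the boundary circle, and for \<alpha> \<le>
  -1 it has infinite total mass, so partial sums cannot simply be integrated over the whole disc.
  The coefficient formula is therefore proved first for bounded weights supported in a smaller disc,
  where dominated convergence applies; monotone convergence over growing discs then gives it in
  [0, \<infinity>] for every \<alpha>. One identity thus serves both the finiteness criterion and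
  the triviality for \<alpha> \<le> -1.

  Differentiating m times multiplies the coefficient of z^n by n! / (n - m)! and moves it to z^(n -
  m). The weights for n \<ge> m are therefore rescaled norms of lower monomials. Their consecutive
  ratios still tend to R^2, which is why the kernel series converges on the whole disc for every m.

  Inner products are not expanded separately: polarization reduces them to squared norms.\<close>

text \<open>
  Balls go to balls of the same radius, and Vitali's theorem exhausts \<open>U\<close> by disjoint balls up to a
  null set.  Only one inequality comes out, as the preimage of the null set is not controlled; the
  inverse rotation supplies the other one.
\<close>

lemma emeasure_rotation_vimage_ge:
  fixes c :: complex and U :: "complex set"
  assumes c: "cmod c = 1" and U: "open U"
  shows "emeasure lborel U \<le> emeasure lborel ((\<lambda>z. c * z) -` U)"
proof -
  define K where "K = {(x, r). r > 0 \<and> ball x r \<subseteq> U}"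
  have "\<exists>i. i \<in> K \<and> x \<in> ball (fst i) (snd i) \<and> snd i < d" if "x \<in> U" "0 < d" for x d
  proof -
    from U that obtain e where e: "e > 0" "ball x e \<subseteq> U" by (meson openE)
    then have "(x, min e (d/2)) \<in> K" using that by (auto simp: K_def)
    then show ?thesis using e that by (intro exI[of _ "(x, min e (d/2))"]) auto
  qed
  then obtain C where C: "countable C" "C \<subseteq> K"
     "pairwise (\<lambda>i j. disjnt (ball (fst i) (snd i)) (ball (fst j) (snd j))) C"
     "negligible (U - (\<Union>i\<in>C. ball (fst i) (snd i)))"
    by (rule Vitali_covering_theorem_balls[of U K fst snd]) blast
  define B where "B i = ball (fst i) (snd i)" for i :: "complex \<times> real"
  have dB: "disjoint_family_on B C"
    using C(3) by (auto simp: disjoint_family_on_def pairwise_def disjnt_def B_def)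
  have BU: "B i \<subseteq> U" if "i \<in> C" for i
    using C(2) that by (cases i) (auto simp: K_def B_def simp del: mem_ball)
  have mB: "B i \<in> sets borel" for i by (simp add: B_def)
  define V where "V i = (\<lambda>z. c * z) -` B i" for i
  have V: "V i = ball (fst i / c) (snd i)" for i
  proof -
    have "dist (fst i / c) z = dist (fst i) (c * z)" for z
    proof -
      have "c \<noteq> 0" using c by auto
      then have "fst i - c * z = c * (fst i / c - z)" by (simp add: field_simps)
      then show ?thesis by (simp add: dist_norm norm_mult c)
    qed
    then show ?thesis by (auto simp: V_def B_def)
  qed
  have mV: "V i \<in> sets borel" for i by (simp add: V)
  have dV: "disjoint_family_on V C"
    using dB unfolding V_def disjoint_family_on_def by blast
  have meas: "(\<Union>i\<in>C. B i) \<in> sets lborel"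
    unfolding sets_lborel by (intro borel_open open_UN) (auto simp: B_def)
  have null: "U - (\<Union>i\<in>C. B i) \<in> null_sets lborel"
  proof -
    have "U - (\<Union>i\<in>C. B i) \<in> sets lborel" using U meas by (intro sets.Diff) auto
    moreover have "U - (\<Union>i\<in>C. B i) \<in> null_sets lebesgue"
      using C(4) by (simp add: negligible_iff_null_sets B_def)
    ultimately show ?thesis by (simp add: null_sets_completion_iff)
  qed
  have "emeasure lborel U = emeasure lborel ((\<Union>i\<in>C. B i) \<union> (U - (\<Union>i\<in>C. B i)))"
    using BU by (intro arg_cong[of _ _ "emeasure lborel"]) auto
  also have "\<dots> = emeasure lborel (\<Union>i\<in>C. B i)"
    using null meas by (rule emeasure_Un_null_set[rotated])
  also have "\<dots> = (\<integral>\<^sup>+i. emeasure lborel (B i) \<partial>count_space C)"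
    using C(1) dB by (intro emeasure_UN_countable) (simp_all add: mB)
  also have "\<dots> = (\<integral>\<^sup>+i. emeasure lborel (V i) \<partial>count_space C)"
  proof (intro nn_integral_cong)
    fix i assume "i \<in> space (count_space C)"
    then have "snd i > 0" using C(2) by (auto simp: K_def)
    then show "emeasure lborel (B i) = emeasure lborel (V i)"
      by (simp add: B_def V emeasure_ball)
  qed
  also have "\<dots> = emeasure lborel (\<Union>i\<in>C. V i)"
    using C(1) dV by (intro emeasure_UN_countable[symmetric]) (simp_all add: mV)
  also have "\<dots> \<le> emeasure lborel ((\<lambda>z. c * z) -` U)"
  proof (intro emeasure_mono)
    show "(\<Union>i\<in>C. V i) \<subseteq> (\<lambda>z. c * z) -` U" using BU by (auto simp: V_def)
    have "open ((\<lambda>z. c * z) -` U)" using U by (intro open_vimage continuous_intros)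
    then show "(\<lambda>z. c * z) -` U \<in> sets lborel" by simp
  qed
  finally show ?thesis .
qed

text \<open>Boxes are enough to identify the measure. The preimage of a box is no longer a box but
  is still open, which is why the inequality above is stated for all open sets: here it is applied
  to that preimage as well.\<close>

lemma lborel_distr_rotation:
  fixes c :: complex
  assumes c: "cmod c = 1"
  shows "distr lborel borel (\<lambda>z. c * z) = lborel"
proof (rule lborel_eqI[symmetric])
  fix l u :: complex
  assume lu: "\<And>b. b \<in> Basis \<Longrightarrow> l \<bullet> b \<le> u \<bullet> b"
  let ?U = "box l u" and ?V = "(\<lambda>z. c * z) -` box l u"
  have oV: "open ?V" by (intro open_vimage continuous_intros open_box)
  have "emeasure lborel ?V \<le> emeasure lborel ((\<lambda>z. cnj c * z) -` ?V)"
    using c oV by (intro emeasure_rotation_vimage_ge) auto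
  also have "(\<lambda>z. cnj c * z) -` ?V = ?U"
    using c complex_norm_square[of c] by (auto simp: mult.assoc[symmetric])
  finally have "emeasure lborel ?V = emeasure lborel ?U"
    using emeasure_rotation_vimage_ge[OF c open_box, of l u] by (intro antisym)
  then show "emeasure (distr lborel borel (\<lambda>z. c * z)) ?U = ennreal (\<Prod>b\<in>Basis. (u - l) \<bullet> b)"
    using lu by (simp add: emeasure_distr emeasure_lborel_box)
qed simp

text \<open>Rotating by the angle pi / (j - k) multiplies the integrand by -1, so the integral
  equals its own negative. A divergent integral has the default value 0, in agreement with the
  claim.\<close>

lemma integral_radial_monomials_orthogonal:
  fixes h :: "real \<Rightarrow> real"
  assumes [measurable]: "h \<in> borel_measurable borel" and "j \<noteq> k"
  shows "(\<integral>z. z ^ j * cnj z ^ k * of_real (h (cmod z)) \<partial>lborel) = 0"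
proof -
  define c where "c = cis (pi / (real j - real k))"
  have c: "cmod c = 1" by (simp add: c_def)
  have jk: "real j - real k \<noteq> 0" using assms by simp
  have "c ^ j * cnj c ^ k = cis (pi / (real j - real k) * (real j - real k))"
    by (simp add: c_def Complex.DeMoivre cis_mult cis_cnj algebra_simps diff_divide_distrib)
  also have "\<dots> = -1" using jk by simp
  finally have m: "c ^ j * cnj c ^ k = -1" .
  let ?f = "\<lambda>z. z ^ j * cnj z ^ k * of_real (h (cmod z))"
  have [measurable]: "cnj \<in> borel_measurable borel"
    by (intro borel_measurable_continuous_onI continuous_intros)
  have [measurable]: "?f \<in> borel_measurable borel" by measurable
  have "(\<integral>z. ?f z \<partial>lborel) = (\<integral>z. ?f z \<partial>distr lborel borel (\<lambda>z. c * z))"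
    by (simp add: lborel_distr_rotation c)
  also have "\<dots> = (\<integral>z. ?f (c * z) \<partial>lborel)"
    by (rule integral_distr) auto
  also have "\<dots> = (\<integral>z. - ?f z \<partial>lborel)"
  proof (intro Bochner_Integration.integral_cong refl)
    fix z
    have "?f (c * z) = (c ^ j * cnj c ^ k) * ?f z"
      by (simp add: c norm_mult power_mult_distrib)
    then show "?f (c * z) = - ?f z" by (simp add: m)
  qed
  finally show ?thesis by simp
qed

text \<open>This stands in for polar coordinates: the set where
  \<open>(cmod z)\<^sup>2 \<le> a\<close> is a disc of area pi * a, linear in a, so the image
  measure has constant density. The half-lines are closed under intersection and generate the Borel
  sets, hence they determine it.\<close>

lemma lborel_distr_norm_square:
  "distr lborel borel (\<lambda>z::complex. (cmod z)\<^sup>2) = density lborel (\<lambda>t::real. ennreal pi * indicator {0..} t)"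
proof -
  have sq_le: "(cmod z)\<^sup>2 \<le> a \<longleftrightarrow> cmod z \<le> sqrt a" if "0 \<le> a" for z :: complex and a
    using real_le_rsqrt[of "cmod z" a] sqrt_ge_absD[of "cmod z" a] by auto
  show ?thesis
  proof (rule measure_eqI_generator_eq[where E = "range (\<lambda>a::real. {..a})" and \<Omega> = UNIV
        and A = "\<lambda>n. {..real n}"])
    fix X :: "real set" assume "X \<in> range (\<lambda>a. {..a})"
    then obtain a where X: "X = {..a}" by auto
    have "emeasure (density lborel (\<lambda>t. ennreal pi * indicator {0..} t)) X
       = (\<integral>\<^sup>+t. ennreal pi * indicator {0..a} t \<partial>lborel)"
      by (simp add: X emeasure_density) (intro nn_integral_cong, auto split: split_indicator)
    also have "\<dots> = ennreal pi * ennreal (max 0 a)"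
      by (cases "0 \<le> a") (simp_all add: nn_integral_cmult)
    finally have r: "emeasure (density lborel (\<lambda>t. ennreal pi * indicator {0..} t)) X = ennreal (pi * max 0 a)"
      by (simp add: ennreal_mult)
    have "(\<lambda>z::complex. (cmod z)\<^sup>2) -` {..a} = (if a < 0 then {} else cball 0 (sqrt a))"
      using order_trans[OF zero_le_power2, of _ a] by (auto simp: not_less sq_le)
    then have "emeasure (distr lborel borel (\<lambda>z::complex. (cmod z)\<^sup>2)) X = ennreal (pi * max 0 a)"
      by (auto simp: X emeasure_distr emeasure_cball unit_ball_vol_2)
    with r show "emeasure (distr lborel borel (\<lambda>z::complex. (cmod z)\<^sup>2)) X
        = emeasure (density lborel (\<lambda>t. ennreal pi * indicator {0..} t)) X" by simp
  next
    fix n :: nat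
    have "(\<lambda>z::complex. (cmod z)\<^sup>2) -` {..real n} = cball 0 (sqrt n)"
      by (auto simp: sq_le)
    then show "emeasure (distr lborel borel (\<lambda>z::complex. (cmod z)\<^sup>2)) {..real n} \<noteq> \<infinity>"
      by (simp add: emeasure_distr emeasure_cball)
  next
    show "Int_stable (range (\<lambda>a::real. {..a}))" by (auto simp: Int_stable_def)
    show "(\<Union>n. {..real n}) = UNIV" using real_arch_simple by auto
  qed (auto simp: borel_eq_atMost)
qed

lemma nn_integral_radial:
  fixes f :: "real \<Rightarrow> ennreal"
  assumes [measurable]: "f \<in> borel_measurable borel"
  shows "(\<integral>\<^sup>+z. f ((cmod z)\<^sup>2) \<partial>lborel) = ennreal pi * (\<integral>\<^sup>+t. f t * indicator {0..} t \<partial>lborel)"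
proof -
  have "(\<integral>\<^sup>+z. f ((cmod z)\<^sup>2) \<partial>lborel) = (\<integral>\<^sup>+t. f t \<partial>distr lborel borel (\<lambda>z::complex. (cmod z)\<^sup>2))"
    by (rule nn_integral_distr[symmetric]) auto
  then show ?thesis
    by (simp add: lborel_distr_norm_square nn_integral_density nn_integral_cmult[symmetric] mult_ac)
qed

section \<open>Parseval's identity for radial weights\<close>

text \<open>Everything is dominated by a constant on a ball: inside radius \<open>r\<close> the
  partial sums stay below \<open>C\<close>, the sum of all \<open>cmod (b k) * r ^ k\<close>, and
  from \<open>r\<close> on the weight vanishes. Orthogonality evaluates the partial sums, and
  dominated convergence passes to \<open>g\<close>.\<close>

lemma parseval_radial_bounded:
  fixes h :: "real \<Rightarrow> real" and b :: "nat \<Rightarrow> complex" and g :: "complex \<Rightarrow> complex"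
  assumes [measurable]: "h \<in> borel_measurable borel" "g \<in> borel_measurable borel"
    and h0: "\<And>t. 0 \<le> h t" and hB: "\<And>t. h t \<le> B" and hr: "\<And>t. r \<le> t \<Longrightarrow> h t = 0"
    and b: "summable (\<lambda>k. cmod (b k) * r ^ k)"
    and g: "\<And>z. cmod z < r \<Longrightarrow> (\<lambda>k. b k * z ^ k) sums g z"
  shows "(\<integral>\<^sup>+z. ennreal ((cmod (g z))\<^sup>2 * h (cmod z)) \<partial>lborel) =
    (\<Sum>k. ennreal ((cmod (b k))\<^sup>2) * (\<integral>\<^sup>+z. ennreal ((cmod z) ^ (2 * k) * h (cmod z)) \<partial>lborel))"
proof -
  have [measurable]: "cnj \<in> borel_measurable borel"
    by (intro borel_measurable_continuous_onI continuous_intros)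
  have B0: "0 \<le> B" using h0[of 0] hB[of 0] by linarith
  define S where "S N z = (\<Sum>k<N. b k * z ^ k)" for N z
  have [measurable]: "S N \<in> borel_measurable borel" for N
    unfolding S_def by measurable
  define C where "C = (\<Sum>k. cmod (b k) * r ^ k)"
  have dom: "integrable lborel (\<lambda>z::complex. c * indicator (ball 0 r) z)" for c :: real
    by (intro integrable_mult_right integrable_real_indicator emeasure_lborel_ball_finite) simp
  \<comment> \<open>One majorant for the monomials, for \<open>g\<close> and for the partial sums:
    inside the disc \<open>p\<close> is at most \<open>c\<close> and \<open>h\<close> at most
    \<open>B\<close>, outside \<open>h\<close> vanishes.\<close>
  have bound: "norm (p z * h (cmod z)) \<le> norm (c * B * indicator (ball 0 r) z)"
    if "0 \<le> c" "\<And>z. cmod z < r \<Longrightarrow> \<bar>p z\<bar> \<le> c" for p :: "complex \<Rightarrow> real" and c z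
  proof (cases "cmod z < r")
    case True
    then show ?thesis using that h0[of "cmod z"] hB[of "cmod z"] B0
      by (auto simp: abs_mult intro!: mult_mono)
  next
    case False
    then show ?thesis by (simp add: hr)
  qed
  have pow_le: "cmod z ^ n \<le> r ^ n" if "cmod z < r" for z n
    using that by (intro power_mono) auto
  \<comment> \<open>The sign of \<open>r\<close> is not assumed, while \<open>bound\<close> asks for
    a nonnegative constant; hence \<open>\<bar>r\<bar>\<close>.\<close>
  have int_pow: "integrable lborel (\<lambda>z. cmod z ^ n * h (cmod z))" for n
  proof (rule Bochner_Integration.integrable_bound[OF dom[of "\<bar>r\<bar> ^ n * B"]])
    show "AE z in lborel. norm (cmod z ^ n * h (cmod z)) \<le> norm (\<bar>r\<bar> ^ n * B * indicator (ball 0 r) z)"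
      by (intro AE_I2 bound) (auto intro!: power_mono)
  qed measurable
  have int_mon: "integrable lborel (\<lambda>z. z ^ j * cnj z ^ k * of_real (h (cmod z)))" for j k
    by (rule Bochner_Integration.integrable_bound[OF int_pow[of "j + k"]])
       (auto simp: norm_mult norm_power power_add h0)
  define m where "m k = (\<integral>z. cmod z ^ (2 * k) * h (cmod z) \<partial>lborel)" for k
  have m0: "0 \<le> m k" for k
    unfolding m_def by (intro integral_nonneg_AE AE_I2) (simp add: h0)
  have mono_int: "(\<integral>z. z ^ j * cnj z ^ k * of_real (h (cmod z)) \<partial>lborel) = (if j = k then of_real (m k) else 0)" for j k
  proof (cases "j = k")
    case True
    have "(\<integral>z. z ^ k * cnj z ^ k * of_real (h (cmod z)) \<partial>lborel)
      = (\<integral>z. complex_of_real (cmod z ^ (2 * k) * h (cmod z)) \<partial>lborel)"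
      by (intro Bochner_Integration.integral_cong refl)
         (simp add: power_mult_distrib[symmetric] complex_norm_square[symmetric] power_mult)
    then show ?thesis using True by (simp add: m_def del: of_real_mult of_real_power)
  next
    case False
    then show ?thesis by (simp add: integral_radial_monomials_orthogonal)
  qed
  have SN: "(\<integral>z. (cmod (S N z))\<^sup>2 * h (cmod z) \<partial>lborel) = (\<Sum>k<N. (cmod (b k))\<^sup>2 * m k)" for N
  proof -
    have "complex_of_real (\<integral>z. (cmod (S N z))\<^sup>2 * h (cmod z) \<partial>lborel)
      = (\<integral>z. complex_of_real ((cmod (S N z))\<^sup>2 * h (cmod z)) \<partial>lborel)"
      by (simp del: of_real_mult of_real_power)
    also have "\<dots> = (\<integral>z. (\<Sum>j<N. \<Sum>k<N. b j * cnj (b k) * (z ^ j * cnj z ^ k * of_real (h (cmod z)))) \<partial>lborel)"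
    proof (intro Bochner_Integration.integral_cong refl)
      fix z
      have "complex_of_real ((cmod (S N z))\<^sup>2 * h (cmod z)) = S N z * cnj (S N z) * of_real (h (cmod z))"
        by (simp only: of_real_mult complex_norm_square)
      also have "S N z * cnj (S N z) = (\<Sum>j<N. \<Sum>k<N. b j * z ^ j * (cnj (b k) * cnj z ^ k))"
        by (simp add: S_def sum_product)
      finally show "complex_of_real ((cmod (S N z))\<^sup>2 * h (cmod z))
        = (\<Sum>j<N. \<Sum>k<N. b j * cnj (b k) * (z ^ j * cnj z ^ k * of_real (h (cmod z))))"
        by (simp only: sum_distrib_right) (simp only: mult_ac)
    qed
    also have "\<dots> = (\<Sum>j<N. \<Sum>k<N. b j * cnj (b k) * (if j = k then of_real (m k) else 0))"
      by (simp add: int_mon mono_int)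
    also have "\<dots> = (\<Sum>j<N. of_real ((cmod (b j))\<^sup>2 * m j))"
      by (simp add: complex_norm_square if_distrib sum.delta cong: if_cong del: of_real_power)
    also have "\<dots> = of_real (\<Sum>j<N. (cmod (b j))\<^sup>2 * m j)" by simp
    finally show ?thesis by (simp only: of_real_eq_iff)
  qed
  have Cb: "cmod (S N z) \<le> C" and Cg: "cmod (g z) \<le> C" if z: "cmod z < r" for N z
  proof -
    have r0: "0 \<le> r" using z norm_ge_zero[of z] by linarith
    have le: "cmod (S N z) \<le> C" for N
    proof -
      have "cmod (S N z) \<le> (\<Sum>k<N. cmod (b k) * r ^ k)"
        unfolding S_def using pow_le[OF z]
        by (intro order_trans[OF norm_sum] sum_mono) (auto simp: norm_mult norm_power intro: mult_left_mono)
      also have "\<dots> \<le> C"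
        unfolding C_def using r0 by (intro sum_le_suminf b) auto
      finally show ?thesis .
    qed
    then show "cmod (S N z) \<le> C" .
    have "(\<lambda>N. cmod (S N z)) \<longlonglongrightarrow> cmod (g z)"
      using g[OF z] unfolding sums_def S_def by (rule tendsto_norm)
    then show "cmod (g z) \<le> C" by (rule LIMSEQ_le_const2) (use le in auto)
  qed
  have int_g: "integrable lborel (\<lambda>z. (cmod (g z))\<^sup>2 * h (cmod z))"
  proof (rule Bochner_Integration.integrable_bound[OF dom[of "C\<^sup>2 * B"]])
    show "AE z in lborel. norm ((cmod (g z))\<^sup>2 * h (cmod z)) \<le> norm (C\<^sup>2 * B * indicator (ball 0 r) z)"
      using Cg by (intro AE_I2 bound) (auto intro!: power_mono)
  qed measurable
  have lim: "(\<lambda>N. \<integral>z. (cmod (S N z))\<^sup>2 * h (cmod z) \<partial>lborel) \<longlonglongrightarrow> (\<integral>z. (cmod (g z))\<^sup>2 * h (cmod z) \<partial>lborel)"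
  proof (rule integral_dominated_convergence[where w = "\<lambda>z. \<bar>C\<^sup>2 * B * indicator (ball 0 r) z\<bar>"])
    show "integrable lborel (\<lambda>z::complex. \<bar>C\<^sup>2 * B * indicator (ball 0 r) z\<bar>)"
      by (intro integrable_abs dom)
    show "AE z in lborel. norm ((cmod (S N z))\<^sup>2 * h (cmod z)) \<le> \<bar>C\<^sup>2 * B * indicator (ball 0 r) z\<bar>" for N
      unfolding real_norm_def[symmetric]
      using Cb by (intro AE_I2 bound) (auto intro!: power_mono)
    show "AE z in lborel. (\<lambda>N. (cmod (S N z))\<^sup>2 * h (cmod z)) \<longlonglongrightarrow> (cmod (g z))\<^sup>2 * h (cmod z)"
    proof (intro AE_I2)
      fix z
      show "(\<lambda>N. (cmod (S N z))\<^sup>2 * h (cmod z)) \<longlonglongrightarrow> (cmod (g z))\<^sup>2 * h (cmod z)"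
      proof (cases "cmod z < r")
        case True
        then have "(\<lambda>N. S N z) \<longlonglongrightarrow> g z" using g by (simp add: sums_def S_def)
        then show ?thesis by (intro tendsto_intros)
      qed (simp add: hr)
    qed
  qed measurable
  then have sums: "(\<lambda>k. (cmod (b k))\<^sup>2 * m k) sums (\<integral>z. (cmod (g z))\<^sup>2 * h (cmod z) \<partial>lborel)"
    by (simp add: SN sums_def)
  have "(\<integral>\<^sup>+z. ennreal ((cmod (g z))\<^sup>2 * h (cmod z)) \<partial>lborel)
     = ennreal (\<integral>z. (cmod (g z))\<^sup>2 * h (cmod z) \<partial>lborel)"
    by (intro nn_integral_eq_integral int_g AE_I2) (simp add: h0)
  also have "\<dots> = (\<Sum>k. ennreal ((cmod (b k))\<^sup>2 * m k))"
    using sums m0 by (intro suminf_ennreal_eq[symmetric]) auto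
  also have "\<dots> = (\<Sum>k. ennreal ((cmod (b k))\<^sup>2) * (\<integral>\<^sup>+z. ennreal ((cmod z) ^ (2 * k) * h (cmod z)) \<partial>lborel))"
    unfolding m_def by (subst nn_integral_eq_integral[OF int_pow]) (auto simp: h0 ennreal_mult')
  finally show ?thesis .
qed

text \<open>The weight may blow up at \<open>R\<close> and its moments may be infinite, so
  \<open>hB\<close> asks for bounds on smaller discs only. Cutting \<open>h\<close> off at the radii
  \<open>r n\<close> reduces to the bounded case, and both sides increase to their values for
  \<open>h\<close>.\<close>

lemma parseval_radial:
  fixes h :: "real \<Rightarrow> real" and b :: "nat \<Rightarrow> complex" and g :: "complex \<Rightarrow> complex"
  assumes [measurable]: "h \<in> borel_measurable borel" "g \<in> borel_measurable borel"
    and h0: "\<And>t. 0 \<le> h t" and hB: "\<And>r. r < R \<Longrightarrow> \<exists>B. \<forall>t. 0 \<le> t \<and> t < r \<longrightarrow> h t \<le> B"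
    and hR: "\<And>t. R \<le> t \<Longrightarrow> h t = 0" and R: "0 < R"
    and g: "\<And>z. cmod z < R \<Longrightarrow> (\<lambda>k. b k * z ^ k) sums g z"
  shows "(\<integral>\<^sup>+z. ennreal ((cmod (g z))\<^sup>2 * h (cmod z)) \<partial>lborel) =
    (\<Sum>k. ennreal ((cmod (b k))\<^sup>2) * (\<integral>\<^sup>+z. ennreal ((cmod z) ^ (2 * k) * h (cmod z)) \<partial>lborel))"
proof -
  define r where "r n = R * (1 - 1 / real (Suc n))" for n :: nat
  \<comment> \<open>The cut at 0 is there because \<open>hB\<close> bounds \<open>h\<close> for
    nonnegative arguments only, whereas the bounded case wants a bound on the whole line.\<close>
  define H where "H n t = (if 0 \<le> t \<and> t < r n then h t else 0)" for n t
  have r: "0 \<le> r n" "r n < R" for n using R by (auto simp: r_def)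
  have r_mono: "r n \<le> r n'" if "n \<le> n'" for n n'
    using that R by (auto simp: r_def intro!: mult_left_mono divide_left_mono)
  have r_lim: "\<exists>n. t < r n" if "t < R" for t
  proof -
    have "r \<longlonglongrightarrow> R * (1 - 0)"
      unfolding r_def by (intro tendsto_intros LIMSEQ_Suc[OF lim_1_over_n])
    then have "eventually (\<lambda>n. t < r n) sequentially" using that by (auto dest: order_tendstoD(1))
    then show ?thesis by (auto simp: eventually_sequentially)
  qed
  have [measurable]: "H n \<in> borel_measurable borel" for n unfolding H_def by measurable
  have Hh: "H n t \<le> h t" "0 \<le> H n t" for n t by (auto simp: H_def h0)
  have H_mono: "H n t \<le> H n' t" if "n \<le> n'" for n n' t
    using r_mono[OF that] by (auto simp: H_def h0)
  \<comment> \<open>Stated for general \<open>p\<close> because it serves both sides of the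
    identity: the squared modulus of \<open>g\<close> and the powers of
    \<open>cmod z\<close>.\<close>
  have sup: "(\<integral>\<^sup>+z. ennreal (p z * h (cmod z)) \<partial>lborel) = (SUP n. \<integral>\<^sup>+z. ennreal (p z * H n (cmod z)) \<partial>lborel)"
    and inc: "incseq (\<lambda>n. \<integral>\<^sup>+z. ennreal (p z * H n (cmod z)) \<partial>lborel)"
    if [measurable]: "p \<in> borel_measurable borel" and p: "\<And>z. 0 \<le> p z" for p :: "complex \<Rightarrow> real"
  proof -
    have inc': "ennreal (p z * H n (cmod z)) \<le> ennreal (p z * H n' (cmod z))" if "n \<le> n'" for n n' z
      using H_mono[OF that] p by (intro ennreal_leI mult_left_mono)
    then show "incseq (\<lambda>n. \<integral>\<^sup>+z. ennreal (p z * H n (cmod z)) \<partial>lborel)"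
      by (auto intro!: incseq_SucI nn_integral_mono)
    have "(SUP n. ennreal (p z * H n (cmod z))) = ennreal (p z * h (cmod z))" for z
    proof (rule antisym)
      show "(SUP n. ennreal (p z * H n (cmod z))) \<le> ennreal (p z * h (cmod z))"
        using p Hh by (intro SUP_least ennreal_leI mult_left_mono)
      show "ennreal (p z * h (cmod z)) \<le> (SUP n. ennreal (p z * H n (cmod z)))"
      proof (cases "cmod z < R")
        case True
        then obtain n where "cmod z < r n" using r_lim by blast
        then show ?thesis by (intro SUP_upper2[of n]) (auto simp: H_def)
      qed (simp add: hR)
    qed
    then have "(\<integral>\<^sup>+z. ennreal (p z * h (cmod z)) \<partial>lborel) = (\<integral>\<^sup>+z. (SUP n. ennreal (p z * H n (cmod z))) \<partial>lborel)"
      by simp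
    also have "\<dots> = (SUP n. \<integral>\<^sup>+z. ennreal (p z * H n (cmod z)) \<partial>lborel)"
      using inc' by (intro nn_integral_monotone_convergence_SUP) (auto simp: incseq_def le_fun_def)
    finally show "(\<integral>\<^sup>+z. ennreal (p z * h (cmod z)) \<partial>lborel) = (SUP n. \<integral>\<^sup>+z. ennreal (p z * H n (cmod z)) \<partial>lborel)" .
  qed
  have eq: "(\<integral>\<^sup>+z. ennreal ((cmod (g z))\<^sup>2 * H n (cmod z)) \<partial>lborel) =
    (\<Sum>k. ennreal ((cmod (b k))\<^sup>2) * (\<integral>\<^sup>+z. ennreal ((cmod z) ^ (2 * k) * H n (cmod z)) \<partial>lborel))" for n
  proof -
    obtain B where B: "\<And>t. 0 \<le> t \<Longrightarrow> t < r n \<Longrightarrow> h t \<le> B" using hB[OF r(2)] by blast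
    \<comment> \<open>Convergence at the larger radius \<open>s\<close> gives absolute convergence
      at \<open>r n\<close>.\<close>
    obtain s where s: "r n < s" "s < R" using dense r(2) by blast
    have "summable (\<lambda>k. b k * complex_of_real s ^ k)"
      using g[of "of_real s"] s r(1)[of n] by (auto intro: sums_summable)
    then have "summable (\<lambda>k. norm (b k * complex_of_real (r n) ^ k))"
      by (rule powser_insidea) (use s r(1)[of n] in auto)
    then have "summable (\<lambda>k. cmod (b k) * r n ^ k)"
      using r(1)[of n] by (simp add: norm_mult norm_power)
    \<comment> \<open>For \<open>n = 0\<close> the range of \<open>t\<close> is empty and
      \<open>B\<close> may be negative, while \<open>H n\<close> takes the value 0; hence
      \<open>max B 0\<close>.\<close>
    then show ?thesis
      using r(2)[of n]
      by (intro parseval_radial_bounded[where r = "r n" and B = "max B 0"])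
         (auto simp: H_def h0 intro!: g max.coboundedI1 B)
  qed
  have "(\<integral>\<^sup>+z. ennreal ((cmod (g z))\<^sup>2 * h (cmod z)) \<partial>lborel) =
    (SUP n. \<Sum>k. ennreal ((cmod (b k))\<^sup>2) * (\<integral>\<^sup>+z. ennreal ((cmod z) ^ (2 * k) * H n (cmod z)) \<partial>lborel))"
    by (subst sup) (auto simp: eq)
  also have "\<dots> = (\<Sum>k. SUP n. ennreal ((cmod (b k))\<^sup>2) * (\<integral>\<^sup>+z. ennreal ((cmod z) ^ (2 * k) * H n (cmod z)) \<partial>lborel))"
  proof (rule ennreal_suminf_SUP_eq[symmetric])
    fix k
    have "incseq (\<lambda>n. \<integral>\<^sup>+z. ennreal ((cmod z) ^ (2 * k) * H n (cmod z)) \<partial>lborel)"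
      by (rule inc) auto
    then show "incseq (\<lambda>n. ennreal ((cmod (b k))\<^sup>2) * (\<integral>\<^sup>+z. ennreal ((cmod z) ^ (2 * k) * H n (cmod z)) \<partial>lborel))"
      by (auto simp: incseq_def intro: mult_left_mono)
  qed
  also have "\<dots> = (\<Sum>k. ennreal ((cmod (b k))\<^sup>2) * (\<integral>\<^sup>+z. ennreal ((cmod z) ^ (2 * k) * h (cmod z)) \<partial>lborel))"
    by (subst sup) (auto simp: SUP_mult_left_ennreal)
  finally show ?thesis .
qed

section \<open>Norms of power series on the disc\<close>

text \<open>The density as a function of the modulus alone, set to 0 from \<open>R\<close> on:
  integrals over the disc become integrals over the plane, where the results on radial weights
  apply.\<close>

definition disc_weight :: "real \<Rightarrow> real \<Rightarrow> real \<Rightarrow> real" where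
  "disc_weight R \<alpha> t = (if t < R then (1 - (t / R)\<^sup>2) powr \<alpha> else 0)"

lemma disc_weight_nonneg: "0 \<le> disc_weight R \<alpha> t"
  by (simp add: disc_weight_def)

lemma disc_weight_measurable [measurable]: "disc_weight R \<alpha> \<in> borel_measurable borel"
  unfolding disc_weight_def by measurable

lemma disc_weight_bounded:
  assumes "0 < R" "r < R"
  shows "\<exists>B. \<forall>t. 0 \<le> t \<and> t < r \<longrightarrow> disc_weight R \<alpha> t \<le> B"
proof (intro exI allI impI)
  fix t assume t: "0 \<le> t \<and> t < r"
  have "(t / R)\<^sup>2 \<le> (r / R)\<^sup>2" using t assms by (intro power_mono divide_right_mono) auto
  moreover have "(r / R)\<^sup>2 < 1" using t assms by (simp add: power_divide power_strict_mono)
  ultimately have *: "0 < 1 - (r / R)\<^sup>2" "1 - (r / R)\<^sup>2 \<le> 1 - (t / R)\<^sup>2" "1 - (t / R)\<^sup>2 \<le> 1" by auto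
  \<comment> \<open>For \<alpha> \<ge> 0 the weight is at most 1; for \<alpha> < 0 it increases with
    the radius.\<close>
  have "(1 - (t / R)\<^sup>2) powr \<alpha> \<le> max 1 ((1 - (r / R)\<^sup>2) powr \<alpha>)"
  proof (cases "0 \<le> \<alpha>")
    case True
    then have "(1 - (t / R)\<^sup>2) powr \<alpha> \<le> 1" using * by (intro powr_le1) auto
    then show ?thesis by simp
  next
    case False
    then have "(1 - (t / R)\<^sup>2) powr \<alpha> \<le> (1 - (r / R)\<^sup>2) powr \<alpha>" using * by (intro powr_mono2') auto
    then show ?thesis by simp
  qed
  then show "disc_weight R \<alpha> t \<le> max 1 ((1 - (r / R)\<^sup>2) powr \<alpha>)"
    by (auto simp: disc_weight_def)
qed

lemma sets_disc_measure: "sets (disc_measure R \<alpha>) = sets (restrict_space borel (ball 0 R))"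
  by (auto simp: disc_measure_def sets_restrict_space)

lemma borel_measurable_disc_measure:
  fixes g :: "complex \<Rightarrow> 'a::real_normed_vector"
  assumes "continuous_on (ball 0 R) g"
  shows "g \<in> borel_measurable (disc_measure R \<alpha>)"
proof -
  have "g \<in> borel_measurable (restrict_space borel (ball 0 R))"
    using assms by (rule borel_measurable_continuous_on_restrict)
  then show ?thesis
    by (subst measurable_cong_sets[OF sets_disc_measure refl])
qed

lemma nn_integral_disc_measure:
  assumes "(\<lambda>z. f z) \<in> borel_measurable (restrict_space borel (ball 0 R))" and "0 < R"
  shows "(\<integral>\<^sup>+z. f z \<partial>disc_measure R \<alpha>) = (\<integral>\<^sup>+z. f z * ennreal (disc_weight R \<alpha> (cmod z)) \<partial>lborel)"
proof -
  have s: "sets (restrict_space lborel (ball 0 R)) = sets (restrict_space borel (ball (0::complex) R))"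
    by (auto simp: sets_restrict_space)
  have f: "f \<in> borel_measurable (restrict_space lborel (ball 0 R))"
    using assms by (subst measurable_cong_sets[OF s refl])
  have w: "(\<lambda>z. ennreal ((1 - (cmod (z / of_real R))\<^sup>2) powr \<alpha>)) \<in> borel_measurable (restrict_space lborel (ball 0 R))"
    by (intro measurable_restrict_space1) measurable
  have "(\<integral>\<^sup>+z. f z \<partial>disc_measure R \<alpha>)
    = (\<integral>\<^sup>+z. ennreal ((1 - (cmod (z / of_real R))\<^sup>2) powr \<alpha>) * f z \<partial>restrict_space lborel (ball 0 R))"
    unfolding disc_measure_def by (rule nn_integral_density[OF w f])
  also have "\<dots> = (\<integral>\<^sup>+z. ennreal ((1 - (cmod (z / of_real R))\<^sup>2) powr \<alpha>) * f z * indicator (ball 0 R) z \<partial>lborel)"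
    by (rule nn_integral_restrict_space) simp
  also have "\<dots> = (\<integral>\<^sup>+z. f z * ennreal (disc_weight R \<alpha> (cmod z)) \<partial>lborel)"
    using \<open>0 < R\<close> by (intro nn_integral_cong)
      (auto simp: disc_weight_def norm_divide mult.commute split: split_indicator)
  finally show ?thesis .
qed

lemma disc_norm2_eq_lborel:
  assumes "continuous_on (ball 0 R) g" "0 < R"
  shows "disc_norm2 R \<alpha> g = (\<integral>\<^sup>+z. ennreal ((cmod (g z))\<^sup>2 * disc_weight R \<alpha> (cmod z)) \<partial>lborel)"
proof -
  have "(\<lambda>z. ennreal ((cmod (g z))\<^sup>2)) \<in> borel_measurable (restrict_space borel (ball 0 R))"
    by (intro borel_measurable_continuous_on_restrict continuous_on_ennreal continuous_intros assms)
  then show ?thesis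
    unfolding disc_norm2_def by (subst nn_integral_disc_measure) (auto simp: assms ennreal_mult disc_weight_nonneg)
qed

lemma power_series_continuous_on:
  fixes g :: "complex \<Rightarrow> complex"
  assumes "\<And>z. z \<in> ball 0 R \<Longrightarrow> (\<lambda>k. b k * z ^ k) sums g z"
  shows "continuous_on (ball 0 R) g"
  using power_series_holomorphic[of 0 R b g] assms by (auto intro: holomorphic_on_imp_continuous_on)

text \<open>Valid for every \<alpha>, because the sum is taken in [0, \<infinity>]: a monomial may
  have infinite norm, and a zero coefficient then contributes
  \<open>0 * \<infinity> = 0\<close>.\<close>

lemma disc_norm2_power_series:
  assumes R: "0 < R" and g: "\<And>z. z \<in> ball 0 R \<Longrightarrow> (\<lambda>k. b k * z ^ k) sums g z"
  shows "disc_norm2 R \<alpha> g = (\<Sum>k. ennreal ((cmod (b k))\<^sup>2) * disc_norm2 R \<alpha> (\<lambda>z. z ^ k))"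
proof -
  have cont: "continuous_on (ball 0 R) g" using g by (rule power_series_continuous_on)
  \<comment> \<open>The values of \<open>g\<close> off the disc are arbitrary, so \<open>g\<close>
    may fail to be measurable on the plane; its extension by zero is measurable.\<close>
  define G where "G z = indicator (ball 0 R) z *\<^sub>R g z" for z
  have Gm: "G \<in> borel_measurable borel"
    unfolding G_def by (intro borel_measurable_continuous_on_indicator cont) simp
  have "disc_norm2 R \<alpha> g = (\<integral>\<^sup>+z. ennreal ((cmod (G z))\<^sup>2 * disc_weight R \<alpha> (cmod z)) \<partial>lborel)"
    unfolding disc_norm2_eq_lborel[OF cont R]
    by (intro nn_integral_cong) (auto simp: G_def disc_weight_def split: split_indicator)
  also have "\<dots> = (\<Sum>k. ennreal ((cmod (b k))\<^sup>2) * (\<integral>\<^sup>+z. ennreal ((cmod z) ^ (2 * k) * disc_weight R \<alpha> (cmod z)) \<partial>lborel))"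
  proof (rule parseval_radial[where R = R])
    show "\<And>z. cmod z < R \<Longrightarrow> (\<lambda>k. b k * z ^ k) sums G z" using g by (auto simp: G_def)
    show "\<And>t. R \<le> t \<Longrightarrow> disc_weight R \<alpha> t = 0" by (simp add: disc_weight_def)
  qed (use Gm R in \<open>auto intro: disc_weight_nonneg disc_weight_bounded\<close>)
  also have "\<dots> = (\<Sum>k. ennreal ((cmod (b k))\<^sup>2) * disc_norm2 R \<alpha> (\<lambda>z. z ^ k))"
    by (subst disc_norm2_eq_lborel) (auto simp: R norm_power power_mult[symmetric] mult.commute intro!: continuous_intros)
  finally show ?thesis .
qed

section \<open>Norms of monomials as Beta integrals\<close>

lemma disc_norm2_power_eq:
  assumes R: "0 < R"
  shows "disc_norm2 R \<alpha> (\<lambda>z. z ^ k) =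
    ennreal (pi * R ^ (2 * k + 2)) * (\<integral>\<^sup>+s. ennreal (s ^ k * (1 - s) powr \<alpha>) * indicator {0..<1} s \<partial>lborel)"
proof -
  define f where "f t = ennreal (t ^ k * (if t < R\<^sup>2 then (1 - t / R\<^sup>2) powr \<alpha> else 0))" for t
  have [measurable]: "f \<in> borel_measurable borel" unfolding f_def by measurable
  have "f ((cmod z)\<^sup>2) = ennreal ((cmod (z ^ k))\<^sup>2 * disc_weight R \<alpha> (cmod z))" for z
  proof -
    have "(cmod z)\<^sup>2 < R\<^sup>2 \<longleftrightarrow> cmod z < R"
      using R power_strict_mono[of "cmod z" R 2] power2_less_imp_less[of "cmod z" R] by auto
    moreover have "((cmod z)\<^sup>2) ^ k = (cmod (z ^ k))\<^sup>2"
      by (simp add: norm_power mult.commute flip: power_mult)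
    ultimately show ?thesis by (simp add: f_def disc_weight_def power_divide)
  qed
  then have "disc_norm2 R \<alpha> (\<lambda>z. z ^ k) = (\<integral>\<^sup>+z. f ((cmod z)\<^sup>2) \<partial>lborel)"
    using R by (subst disc_norm2_eq_lborel) (auto intro!: continuous_intros)
  also have "\<dots> = ennreal pi * (\<integral>\<^sup>+t. f t * indicator {0..} t \<partial>lborel)"
    by (rule nn_integral_radial) measurable
  \<comment> \<open>Substitution t = R^2 s: the Jacobian contributes R^2 and the factor t^k
    contributes R^(2k).\<close>
  also have "(\<integral>\<^sup>+t. f t * indicator {0..} t \<partial>lborel)
    = ennreal \<bar>R\<^sup>2\<bar> * (\<integral>\<^sup>+s. f (0 + R\<^sup>2 * s) * indicator {0..} (0 + R\<^sup>2 * s) \<partial>lborel)"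
    using R by (intro nn_integral_real_affine) auto
  also have "(\<integral>\<^sup>+s. f (0 + R\<^sup>2 * s) * indicator {0..} (0 + R\<^sup>2 * s) \<partial>lborel)
    = (\<integral>\<^sup>+s. ennreal (R ^ (2 * k)) * (ennreal (s ^ k * (1 - s) powr \<alpha>) * indicator {0..<1} s) \<partial>lborel)"
  proof (intro nn_integral_cong)
    fix s
    have "R\<^sup>2 * s < R\<^sup>2 \<longleftrightarrow> s < 1" "0 \<le> R\<^sup>2 * s \<longleftrightarrow> 0 \<le> s" "(R\<^sup>2 * s) ^ k = R ^ (2 * k) * s ^ k" "R\<^sup>2 * s / R\<^sup>2 = s"
      using R by (simp_all add: zero_le_mult_iff power_mult_distrib power_mult)
    then show "f (0 + R\<^sup>2 * s) * indicator {0..} (0 + R\<^sup>2 * s)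
      = ennreal (R ^ (2 * k)) * (ennreal (s ^ k * (1 - s) powr \<alpha>) * indicator {0..<1} s)"
      using R by (auto simp: f_def ennreal_mult mult.assoc split: split_indicator)
  qed
  also have "\<dots> = ennreal (R ^ (2 * k)) * (\<integral>\<^sup>+s. ennreal (s ^ k * (1 - s) powr \<alpha>) * indicator {0..<1} s \<partial>lborel)"
    by (rule nn_integral_cmult) measurable
  finally have "disc_norm2 R \<alpha> (\<lambda>z. z ^ k) = (ennreal pi * (ennreal \<bar>R\<^sup>2\<bar> * ennreal (R ^ (2 * k)))) *
      (\<integral>\<^sup>+s. ennreal (s ^ k * (1 - s) powr \<alpha>) * indicator {0..<1} s \<partial>lborel)"
    by (simp only: mult.assoc)
  also have "ennreal pi * (ennreal \<bar>R\<^sup>2\<bar> * ennreal (R ^ (2 * k))) = ennreal (pi * R ^ (2 * k + 2))"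
    using R by (simp add: power_add power2_eq_square mult_ac flip: ennreal_mult)
  finally show ?thesis .
qed

lemma nn_integral_Beta:
  assumes "-1 < \<alpha>"
  shows "(\<integral>\<^sup>+s. ennreal (s ^ k * (1 - s) powr \<alpha>) * indicator {0..<1} s \<partial>lborel) = ennreal (Beta (real k + 1) (\<alpha> + 1))"
proof -
  define f where "f s = (if s \<in> {0..1} then s ^ k * (1 - s) powr \<alpha> else 0)" for s :: real
  have "((\<lambda>s. s powr (real k + 1 - 1) * (1 - s) powr (\<alpha> + 1 - 1)) has_integral Beta (real k + 1) (\<alpha> + 1)) {0..1}"
    using assms by (intro has_integral_Beta_real) auto
  then have "((\<lambda>s. s ^ k * (1 - s) powr \<alpha>) has_integral Beta (real k + 1) (\<alpha> + 1)) {0..1}"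
    \<comment> \<open>The integrands can differ only at 0, where for k = 0
      \<open>0 powr 0 = 0\<close> but \<open>0 ^ 0 = 1\<close>.\<close>
    by (rule has_integral_spike_finite[of "{0}", rotated 2]) (auto simp: powr_realpow)
  then have "(f has_integral Beta (real k + 1) (\<alpha> + 1)) UNIV"
    unfolding f_def by (subst has_integral_restrict_UNIV)
  then have "integral\<^sup>N lborel f = ennreal (Beta (real k + 1) (\<alpha> + 1))"
    by (rule nn_integral_has_integral_lborel[rotated 2]) (simp_all add: f_def[abs_def])
  also have "integral\<^sup>N lborel f = (\<integral>\<^sup>+s. ennreal (s ^ k * (1 - s) powr \<alpha>) * indicator {0..<1} s \<partial>lborel)"
    \<comment> \<open>At s = 1 the closed interval adds nothing, because
      \<open>0 powr \<alpha> = 0\<close>.\<close>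
    by (intro nn_integral_cong) (auto simp: f_def split: split_indicator)
  finally show ?thesis by simp
qed

text \<open>Quantifies the blow-up of the Beta function as e tends to 0. For k = 0 there is
  equality, and each step of the recurrence multiplies by (k + 1) / (k + 1 + e), which is at least
  (k + 1) / (k + 2) because e \<le> 1.\<close>

lemma Beta_ge:
  assumes "0 < e" "e \<le> 1"
  shows "1 / (e * (real k + 1)) \<le> Beta (real k + 1) e"
proof (induction k)
  case 0
  have "(1 + e) * Beta (1 + 1) e = 1 * Beta 1 e" "Gamma (e + 1) = e * Gamma e"
    using assms by (intro Beta_plus1_left Gamma_plus1; auto dest: nonpos_Ints_nonpos)+
  moreover have "Gamma e \<noteq> 0" using Gamma_real_pos[of e] assms by linarith
  ultimately show ?case using assms by (simp add: Beta_def add.commute field_simps)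
next
  case (Suc k)
  have "(real k + 1 + e) * Beta (real k + 1 + 1) e = (real k + 1) * Beta (real k + 1) e"
    by (intro Beta_plus1_left) (auto dest: nonpos_Ints_nonpos)
  then have eq: "Beta (real k + 2) e = (real k + 1) / (real k + 1 + e) * Beta (real k + 1) e"
    using assms by (simp add: field_simps)
  have "1 / (e * (real k + 2)) \<le> 1 / (e * (real k + 1 + e))"
    using assms by (intro divide_left_mono mult_left_mono mult_pos_pos) auto
  also have "\<dots> = (real k + 1) / (real k + 1 + e) * (1 / (e * (real k + 1)))"
    using assms by simp
  also have "\<dots> \<le> (real k + 1) / (real k + 1 + e) * Beta (real k + 1) e"
    using Suc assms by (intro mult_left_mono) auto
  finally show ?case by (simp add: eq add.commute)
qed

text \<open>Comparison with the convergent case: since \<alpha> \<le> -1 < e - 1, the integrand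
  dominates the one with exponent e - 1, whose integral is a Beta value of at least 1 / (e (k + 1)),
  arbitrarily large for small e.\<close>

lemma nn_integral_Beta_infinite:
  assumes "\<alpha> \<le> -1"
  shows "(\<integral>\<^sup>+s. ennreal (s ^ k * (1 - s) powr \<alpha>) * indicator {0..<1} s \<partial>lborel) = \<infinity>" (is "?I = _")
proof -
  have le: "ennreal x \<le> ?I" if "1 / (real k + 1) \<le> x" for x
  proof -
    \<comment> \<open>Chosen so that the lower bound of \<open>Beta_ge\<close> equals
      \<open>x\<close>; the condition on \<open>x\<close> says exactly that e \<le> 1.\<close>
    define e where "e = 1 / (x * (real k + 1))"
    have x: "0 < x" using that by (rule less_le_trans[rotated]) auto
    have e: "0 < e" "e \<le> 1" using that x by (auto simp: e_def field_simps)
    have "x = 1 / (e * (real k + 1))" using x by (simp add: e_def)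
    then have "ennreal x \<le> ennreal (Beta (real k + 1) ((e - 1) + 1))"
      using Beta_ge[OF e, of k] by (intro ennreal_leI) simp
    also have "\<dots> = (\<integral>\<^sup>+s. ennreal (s ^ k * (1 - s) powr (e - 1)) * indicator {0..<1} s \<partial>lborel)"
      using e by (intro nn_integral_Beta[symmetric]) auto
    also have "\<dots> \<le> ?I"
      using assms e by (intro nn_integral_mono)
        (auto split: split_indicator intro!: ennreal_leI mult_left_mono powr_mono')
    finally show ?thesis .
  qed
  show ?thesis
  proof (rule ccontr)
    assume "?I \<noteq> \<infinity>"
    then obtain y where y: "?I = ennreal y" "0 \<le> y" by (cases ?I) auto
    \<comment> \<open>Adding 1 exceeds \<open>y\<close> and also meets the lower bound on
      \<open>x\<close> in \<open>le\<close>.\<close>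
    have "ennreal (y + 1) \<le> ?I"
      using y by (intro le) (simp add: field_simps)
    then show False using y by (simp add: ennreal_le_iff)
  qed
qed

text \<open>This is \<open>pi * R ^ (2 * k + 2) * Beta (real k + 1) (\<alpha> + 1)\<close>, for
  \<alpha> > -1 the squared norm of z^k, with the Beta function spelled out in Gamma functions as in
  the norm formula.\<close>

definition disc_moment :: "real \<Rightarrow> real \<Rightarrow> nat \<Rightarrow> real" where
  "disc_moment R \<alpha> k = pi * (fact k * Gamma (\<alpha> + 1) * R ^ (2 * k + 2) / Gamma (real k + \<alpha> + 2))"

lemma disc_moment_pos: "0 < R \<Longrightarrow> -1 < \<alpha> \<Longrightarrow> 0 < disc_moment R \<alpha> k"
  unfolding disc_moment_def by (intro mult_pos_pos divide_pos_pos Gamma_real_pos) auto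

lemma disc_norm2_power:
  assumes "0 < R" "-1 < \<alpha>"
  shows "disc_norm2 R \<alpha> (\<lambda>z. z ^ k) = ennreal (disc_moment R \<alpha> k)"
proof -
  have "0 \<le> Beta (real k + 1) (\<alpha> + 1)"
    using assms by (auto simp: Beta_def intro!: divide_nonneg_nonneg mult_nonneg_nonneg less_imp_le Gamma_real_pos)
  moreover have "pi * R ^ (2 * k + 2) * Beta (real k + 1) (\<alpha> + 1) = disc_moment R \<alpha> k"
    using Gamma_fact[of k, where ?'a = real] by (simp add: disc_moment_def Beta_def add_ac)
  ultimately show ?thesis
    using assms by (simp add: disc_norm2_power_eq nn_integral_Beta ennreal_mult''[symmetric])
qed

lemma disc_norm2_power_infinite:
  assumes "0 < R" "\<alpha> \<le> -1"
  shows "disc_norm2 R \<alpha> (\<lambda>z. z ^ k) = \<infinity>"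
  using assms by (simp add: disc_norm2_power_eq nn_integral_Beta_infinite ennreal_mult_eq_top_iff)

lemma disc_norm2_coeffs:
  assumes "0 < R" "-1 < \<alpha>" and "\<And>z. z \<in> ball 0 R \<Longrightarrow> (\<lambda>k. b k * z ^ k) sums g z"
  shows "disc_norm2 R \<alpha> g = (\<Sum>k. ennreal (disc_moment R \<alpha> k * (cmod (b k))\<^sup>2))"
  using disc_moment_pos[OF assms(1,2)]
  by (subst disc_norm2_power_series[OF assms(1,3)])
    (simp_all add: assms disc_norm2_power ennreal_mult' less_imp_le mult.commute)

text \<open>The identity in [0, \<infinity>] turned into one for Bochner integrals. Integrability is
  recorded because polarization will split one integral into four.\<close>

lemma
  assumes R: "0 < R" "-1 < \<alpha>" and g: "\<And>z. z \<in> ball 0 R \<Longrightarrow> (\<lambda>k. b k * z ^ k) sums g z"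
    and sm: "summable (\<lambda>k. disc_moment R \<alpha> k * (cmod (b k))\<^sup>2)"
  shows integrable_disc_norm_square: "integrable (disc_measure R \<alpha>) (\<lambda>z. (cmod (g z))\<^sup>2)"
    and disc_norm_square_sums:
      "(\<lambda>k. disc_moment R \<alpha> k * (cmod (b k))\<^sup>2) sums (\<integral>z. (cmod (g z))\<^sup>2 \<partial>disc_measure R \<alpha>)"
proof -
  define s where "s = (\<Sum>k. disc_moment R \<alpha> k * (cmod (b k))\<^sup>2)"
  have nonneg: "0 \<le> disc_moment R \<alpha> k * (cmod (b k))\<^sup>2" for k
    using disc_moment_pos[OF R, of k] by simp
  have eq: "(\<integral>\<^sup>+z. ennreal ((cmod (g z))\<^sup>2) \<partial>disc_measure R \<alpha>) = ennreal s"
    using disc_norm2_coeffs[OF R g] suminf_ennreal2[OF nonneg sm] by (simp add: disc_norm2_def s_def)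
  have meas: "(\<lambda>z. (cmod (g z))\<^sup>2) \<in> borel_measurable (disc_measure R \<alpha>)"
    by (intro borel_measurable_disc_measure continuous_intros power_series_continuous_on[OF g])
  show int: "integrable (disc_measure R \<alpha>) (\<lambda>z. (cmod (g z))\<^sup>2)"
    using meas eq by (intro integrableI_nn_integral_finite) auto
  have "ennreal (\<integral>z. (cmod (g z))\<^sup>2 \<partial>disc_measure R \<alpha>) = ennreal s"
    using nn_integral_eq_integral[OF int] eq by simp
  then have "(\<integral>z. (cmod (g z))\<^sup>2 \<partial>disc_measure R \<alpha>) = s"
    using suminf_nonneg[OF sm nonneg] by (subst (asm) ennreal_inj) (auto simp: s_def)
  then show "(\<lambda>k. disc_moment R \<alpha> k * (cmod (b k))\<^sup>2) sums (\<integral>z. (cmod (g z))\<^sup>2 \<partial>disc_measure R \<alpha>)"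
    using sm by (simp add: s_def summable_sums)
qed

section \<open>Weighted square sums, polarization and inner products\<close>

lemma cmod_add_square_le: "(cmod (x + y))\<^sup>2 \<le> 2 * (cmod x)\<^sup>2 + 2 * (cmod y)\<^sup>2"
proof -
  have "(cmod (x + y))\<^sup>2 \<le> (cmod x + cmod y)\<^sup>2"
    by (intro power_mono norm_triangle_ineq) simp
  also have "\<dots> \<le> 2 * (cmod x)\<^sup>2 + 2 * (cmod y)\<^sup>2"
    using sum_squares_bound[of "cmod x" "cmod y"] by (simp add: power2_sum)
  finally show ?thesis .
qed

lemma summable_weighted_add:
  fixes a b :: "nat \<Rightarrow> complex"
  assumes "\<And>n. 0 \<le> W n" and a: "summable (\<lambda>n. W n * (cmod (a n))\<^sup>2)" and b: "summable (\<lambda>n. W n * (cmod (b n))\<^sup>2)"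
  shows "summable (\<lambda>n. W n * (cmod (a n + b n))\<^sup>2)"
proof (rule summable_comparison_test')
  show "summable (\<lambda>n. 2 * (W n * (cmod (a n))\<^sup>2) + 2 * (W n * (cmod (b n))\<^sup>2))"
    by (intro summable_add summable_mult a b)
  show "norm (W n * (cmod (a n + b n))\<^sup>2) \<le> 2 * (W n * (cmod (a n))\<^sup>2) + 2 * (W n * (cmod (b n))\<^sup>2)"
    if "n \<ge> 0" for n
    using mult_left_mono[OF cmod_add_square_le[of "a n" "b n"] assms(1)[of n]] assms(1)[of n]
    by (simp add: algebra_simps)
qed

lemma summable_weighted_scale:
  fixes a :: "nat \<Rightarrow> complex"
  assumes "summable (\<lambda>n. W n * (cmod (a n))\<^sup>2)"
  shows "summable (\<lambda>n. W n * (cmod (c * a n))\<^sup>2)"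
  using summable_mult[OF assms, of "(cmod c)\<^sup>2"] by (simp add: norm_mult power_mult_distrib mult_ac)

text \<open>The multipliers 1 and -1 are kept visible so that all four terms have the shape
  \<open>x + c * y\<close>, and one statement for general \<open>c\<close> covers them.\<close>

lemma polarization:
  fixes x y :: complex
  shows "x * cnj y = (of_real ((cmod (x + 1 * y))\<^sup>2) - of_real ((cmod (x + (-1) * y))\<^sup>2)
    + \<i> * of_real ((cmod (x + \<i> * y))\<^sup>2) - \<i> * of_real ((cmod (x + (-\<i>) * y))\<^sup>2)) / 4"
  unfolding complex_norm_square by (simp add: algebra_simps)

text \<open>Polarization is applied twice, pointwise under the integral and to the coefficients.
  Only squared norms of f + c g have to be expanded, and the product of f and the conjugate of g
  needs no convergence argument of its own.\<close>

lemma disc_ip_sums: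
  assumes R: "0 < R" "-1 < \<alpha>"
    and f: "\<And>z. z \<in> ball 0 R \<Longrightarrow> (\<lambda>k. a k * z ^ k) sums f z"
    and g: "\<And>z. z \<in> ball 0 R \<Longrightarrow> (\<lambda>k. b k * z ^ k) sums g z"
    and a: "summable (\<lambda>k. disc_moment R \<alpha> k * (cmod (a k))\<^sup>2)"
    and b: "summable (\<lambda>k. disc_moment R \<alpha> k * (cmod (b k))\<^sup>2)"
  shows "(\<lambda>k. of_real (disc_moment R \<alpha> k) * (a k * cnj (b k))) sums disc_ip R \<alpha> f g"
proof -
  let ?M = "disc_measure R \<alpha>" and ?m = "disc_moment R \<alpha>"
  have ps: "(\<lambda>k. (a k + c * b k) * z ^ k) sums (f z + c * g z)" if "z \<in> ball 0 R" for c z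
    using sums_add[OF f[OF that] sums_mult[OF g[OF that], of c]] by (simp add: algebra_simps)
  have sm: "summable (\<lambda>k. ?m k * (cmod (a k + c * b k))\<^sup>2)" for c
    using disc_moment_pos[OF R] by (intro summable_weighted_add summable_weighted_scale a b less_imp_le)
  have int: "integrable ?M (\<lambda>z. complex_of_real ((cmod (f z + c * g z))\<^sup>2))" for c
    using integrable_disc_norm_square[OF R ps sm, of c] by (rule integrable_of_real)
  have sums: "(\<lambda>k. of_real (?m k) * of_real ((cmod (a k + c * b k))\<^sup>2)) sums
      (\<integral>z. complex_of_real ((cmod (f z + c * g z))\<^sup>2) \<partial>?M)" for c
    using sums_of_real[OF disc_norm_square_sums[OF R ps sm, of c], where ?'a = complex]
    by (simp only: integral_complex_of_real of_real_mult)
  have "disc_ip R \<alpha> f g = ((\<integral>z. complex_of_real ((cmod (f z + 1 * g z))\<^sup>2) \<partial>?M)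
      - (\<integral>z. complex_of_real ((cmod (f z + (-1) * g z))\<^sup>2) \<partial>?M)
      + \<i> * (\<integral>z. complex_of_real ((cmod (f z + \<i> * g z))\<^sup>2) \<partial>?M)
      - \<i> * (\<integral>z. complex_of_real ((cmod (f z + (-\<i>) * g z))\<^sup>2) \<partial>?M)) / 4"
    unfolding disc_ip_def polarization[of "f _" "g _"]
    by (simp only: integral_divide_zero Bochner_Integration.integral_diff Bochner_Integration.integral_add
        integral_mult_right_zero int integrable_mult_right Bochner_Integration.integrable_add Bochner_Integration.integrable_diff)
  moreover have "(\<lambda>k. of_real (?m k) * (a k * cnj (b k))) =
     (\<lambda>k. (of_real (?m k) * of_real ((cmod (a k + 1 * b k))\<^sup>2) - of_real (?m k) * of_real ((cmod (a k + (-1) * b k))\<^sup>2)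
      + \<i> * (of_real (?m k) * of_real ((cmod (a k + \<i> * b k))\<^sup>2))
      - \<i> * (of_real (?m k) * of_real ((cmod (a k + (-\<i>) * b k))\<^sup>2))) / 4)"
    unfolding polarization[of "a _" "b _"] by (simp add: algebra_simps)
  ultimately show ?thesis
    by (simp only:) (intro sums_divide sums_diff sums_add sums_mult sums)
qed

section \<open>Weighted spaces of power series\<close>

abbreviation taylor_coeff :: "(complex \<Rightarrow> complex) \<Rightarrow> nat \<Rightarrow> complex" where
  "taylor_coeff f n \<equiv> fps_nth (fps_expansion f 0) n"

lemma taylor_sums_holomorphic:
  assumes "f holomorphic_on ball 0 R" "z \<in> ball 0 R"
  shows "(\<lambda>n. taylor_coeff f n * z ^ n) sums f z"
  using holomorphic_power_series[OF assms] by (simp add: fps_expansion_def)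

lemma taylor_sums:
  assumes "f \<in> Hol R" "z \<in> ball 0 R"
  shows "(\<lambda>n. taylor_coeff f n * z ^ n) sums f z"
  using assms by (auto simp: Hol_def intro!: taylor_sums_holomorphic)

lemma taylor_coeff_eqI:
  assumes "0 < R" "\<And>z. z \<in> ball 0 R \<Longrightarrow> (\<lambda>n. a n * z ^ n) sums f z"
  shows "taylor_coeff f n = a n"
proof -
  have "eventually (\<lambda>z. z \<in> ball 0 R) (nhds (0::complex))"
    using assms(1) by (intro eventually_nhds_in_open) auto
  then have "f has_fps_expansion Abs_fps a"
    using assms(2) by (intro has_fps_expansionI) (auto elim!: eventually_mono)
  then show ?thesis by (simp add: fps_expansion_eqI)
qed

lemma HolI:
  assumes "\<And>z. z \<in> ball 0 R \<Longrightarrow> (\<lambda>n. a n * z ^ n) sums f z" "\<And>z. z \<notin> ball 0 R \<Longrightarrow> f z = 0"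
  shows "f \<in> Hol R"
  using power_series_holomorphic[of 0 R a f] assms by (auto simp: Hol_def)

lemma Hol_add: "f \<in> Hol R \<Longrightarrow> g \<in> Hol R \<Longrightarrow> (\<lambda>x. f x + g x) \<in> Hol R"
  and Hol_scale: "f \<in> Hol R \<Longrightarrow> (\<lambda>x. c * f x) \<in> Hol R"
  by (auto simp: Hol_def intro!: holomorphic_intros)

lemma
  assumes "0 < R" "f \<in> Hol R"
  shows taylor_coeff_add: "g \<in> Hol R \<Longrightarrow> taylor_coeff (\<lambda>x. f x + g x) n = taylor_coeff f n + taylor_coeff g n"
    and taylor_coeff_diff: "g \<in> Hol R \<Longrightarrow> taylor_coeff (\<lambda>x. f x - g x) n = taylor_coeff f n - taylor_coeff g n"
    and taylor_coeff_scale: "taylor_coeff (\<lambda>x. c * f x) n = c * taylor_coeff f n"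
proof -
  note f = taylor_sums[OF assms(2)]
  show "taylor_coeff (\<lambda>x. f x + g x) n = taylor_coeff f n + taylor_coeff g n" if "g \<in> Hol R"
    by (rule taylor_coeff_eqI[OF assms(1)]) (use sums_add[OF f taylor_sums[OF that]] in \<open>simp add: ring_distribs\<close>)
  show "taylor_coeff (\<lambda>x. f x - g x) n = taylor_coeff f n - taylor_coeff g n" if "g \<in> Hol R"
    by (rule taylor_coeff_eqI[OF assms(1)]) (use sums_diff[OF f taylor_sums[OF that]] in \<open>simp add: left_diff_distrib\<close>)
  show "taylor_coeff (\<lambda>x. c * f x) n = c * taylor_coeff f n"
    by (rule taylor_coeff_eqI[OF assms(1)]) (use sums_mult[OF f] in \<open>simp add: mult.assoc\<close>)
qed

lemma Hol_eqI:
  assumes "f \<in> Hol R" "g \<in> Hol R" "\<And>n. taylor_coeff f n = taylor_coeff g n"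
  shows "f = g"
proof
  fix z
  show "f z = g z"
  proof (cases "z \<in> ball 0 R")
    case True
    then show ?thesis
      using taylor_sums[OF assms(1) True] taylor_sums[OF assms(2) True] assms(3)
      by (simp add: sums_unique2)
  qed (use assms in \<open>auto simp: Hol_def\<close>)
qed

text \<open>Inside the locale integrals no longer occur: membership and inner product are given by
  coefficients. The condition on the inverse weights has two roles: it makes every weighted
  square-summable sequence the Taylor sequence of a function on the disc, and it makes point
  evaluations bounded.\<close>

locale weighted_power_series_space =
  fixes R :: real and W :: "nat \<Rightarrow> real" and H :: "(complex \<Rightarrow> complex) set"
    and ip :: "(complex \<Rightarrow> complex) \<Rightarrow> (complex \<Rightarrow> complex) \<Rightarrow> complex"
  assumes R_pos: "0 < R" and W_pos: "0 < W n"
    and summable_inverse_weights: "0 \<le> x \<Longrightarrow> x < R\<^sup>2 \<Longrightarrow> summable (\<lambda>n. x ^ n / W n)"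
    and mem_iff: "f \<in> H \<longleftrightarrow> f \<in> Hol R \<and> summable (\<lambda>n. W n * (cmod (taylor_coeff f n))\<^sup>2)"
    and ip_sums: "f \<in> H \<Longrightarrow> g \<in> H \<Longrightarrow>
      (\<lambda>n. of_real (W n) * (taylor_coeff f n * cnj (taylor_coeff g n))) sums ip f g"
begin

lemma in_Hol: "f \<in> H \<Longrightarrow> f \<in> Hol R"
  by (simp add: mem_iff)

lemma add_in: "f \<in> H \<Longrightarrow> g \<in> H \<Longrightarrow> (\<lambda>x. f x + g x) \<in> H"
  using W_pos R_pos
  by (auto simp: mem_iff taylor_coeff_add Hol_add less_imp_le intro!: summable_weighted_add)

lemma scale_in: "f \<in> H \<Longrightarrow> (\<lambda>x. c * f x) \<in> H"
  using R_pos by (auto simp: mem_iff taylor_coeff_scale Hol_scale intro!: summable_weighted_scale)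

lemma diff_in: "f \<in> H \<Longrightarrow> g \<in> H \<Longrightarrow> (\<lambda>x. f x - g x) \<in> H"
  using add_in[of f "\<lambda>x. -1 * g x"] scale_in[of g "-1"] by simp

lemma ip_self:
  assumes "f \<in> H"
  shows "(\<lambda>n. W n * (cmod (taylor_coeff f n))\<^sup>2) sums Re (ip f f)" "ip f f \<in> \<real>"
proof -
  have eq: "of_real (W n) * (taylor_coeff f n * cnj (taylor_coeff f n))
     = complex_of_real (W n * (cmod (taylor_coeff f n))\<^sup>2)" for n
    by (simp only: of_real_mult complex_norm_square)
  have *: "(\<lambda>n. complex_of_real (W n * (cmod (taylor_coeff f n))\<^sup>2)) sums ip f f"
    using ip_sums[OF assms assms] by (simp only: eq)
  show "(\<lambda>n. W n * (cmod (taylor_coeff f n))\<^sup>2) sums Re (ip f f)"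
    using sums_Re[OF *] by simp
  have "Im (ip f f) = 0" using sums_Im[OF *] by (simp add: sums_unique2[OF _ sums_zero])
  then show "ip f f \<in> \<real>" by (simp add: complex_is_Real_iff)
qed

lemma ip_self_nonneg: "f \<in> H \<Longrightarrow> 0 \<le> Re (ip f f)"
  using W_pos by (intro sums_le[OF _ sums_zero ip_self(1)]) (auto simp: less_imp_le)

lemma partial_sum_le:
  assumes "f \<in> H"
  shows "(\<Sum>n<N. W n * (cmod (taylor_coeff f n))\<^sup>2) \<le> Re (ip f f)"
  using W_pos sum_le_suminf[OF sums_summable[OF ip_self(1)[OF assms]], of "{..<N}"]
  by (simp add: sums_unique[OF ip_self(1)[OF assms]] less_imp_le)

text \<open>The product of two numbers is at most the sum of their squares, so the n-th term is at
  most \<open>W n * (cmod (a n))\<^sup>2 + ((cmod z)\<^sup>2) ^ n / W n\<close>, and both series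
  converge. Completeness and the kernel both rest on this.\<close>

lemma exists_with_coeffs:
  assumes a: "summable (\<lambda>n. W n * (cmod (a n))\<^sup>2)"
  obtains f where "f \<in> H" "\<And>n. taylor_coeff f n = a n"
proof -
  define f where "f z = (if z \<in> ball 0 R then \<Sum>n. a n * z ^ n else 0)" for z
  have sums: "(\<lambda>n. a n * z ^ n) sums f z" if "z \<in> ball 0 R" for z
  proof -
    have "(cmod z)\<^sup>2 < R\<^sup>2" using that R_pos by (intro power_strict_mono) auto
    then have "summable (\<lambda>n. W n * (cmod (a n))\<^sup>2 + ((cmod z)\<^sup>2) ^ n / W n)"
      by (intro summable_add a summable_inverse_weights) auto
    moreover have "norm (a n * z ^ n) \<le> W n * (cmod (a n))\<^sup>2 + ((cmod z)\<^sup>2) ^ n / W n" for n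
    proof -
      define s t where "s = sqrt (W n) * cmod (a n)" and "t = cmod z ^ n / sqrt (W n)"
      have "s * t = norm (a n * z ^ n)" using W_pos[of n] by (simp add: s_def t_def norm_mult norm_power)
      moreover have "s\<^sup>2 = W n * (cmod (a n))\<^sup>2" "t\<^sup>2 = ((cmod z)\<^sup>2) ^ n / W n"
        using W_pos[of n] by (simp_all add: s_def t_def power_mult_distrib power_divide mult.commute less_imp_le flip: power_mult)
      moreover have "s * t \<le> s\<^sup>2 + t\<^sup>2"
        using sum_squares_bound[of s t] zero_le_power2[of s] zero_le_power2[of t] by linarith
      ultimately show ?thesis by simp
    qed
    ultimately have "summable (\<lambda>n. a n * z ^ n)"
      by (rule summable_comparison_test'[where N = 0])
    then show ?thesis using that by (simp add: f_def summable_sums)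
  qed
  have "f \<in> Hol R" using sums by (intro HolI[of R a]) (auto simp: f_def)
  moreover have "taylor_coeff f n = a n" for n
    using R_pos sums by (intro taylor_coeff_eqI)
  ultimately show ?thesis using that a by (simp add: mem_iff)
qed

text \<open>The parameter comes first, so that \<open>kernel_function w\<close> is itself the
  element of \<open>H\<close> that represents evaluation at \<open>w\<close>.\<close>

definition kernel_function :: "complex \<Rightarrow> complex \<Rightarrow> complex" where
  "kernel_function w z = (if z \<in> ball 0 R then \<Sum>n. (z * cnj w) ^ n / of_real (W n) else 0)"

lemma kernel_coeffs_summable:
  assumes "w \<in> ball 0 R"
  shows "summable (\<lambda>n. W n * (cmod (cnj w ^ n / of_real (W n)))\<^sup>2)"
proof -
  have "W n * (cmod (cnj w ^ n / of_real (W n)))\<^sup>2 = ((cmod w)\<^sup>2) ^ n / W n" for n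
    using W_pos[of n]
    by (simp add: norm_divide norm_power power_divide power2_eq_square[of "W n"] mult.commute flip: power_mult)
  moreover have "(cmod w)\<^sup>2 < R\<^sup>2" using assms R_pos by (intro power_strict_mono) auto
  ultimately show ?thesis by (simp add: summable_inverse_weights)
qed

text \<open>The coefficients are forced by the reproducing property: the weight \<open>W n\<close>
  of the inner product has to cancel, and conjugation has to leave \<open>w ^ n\<close>.\<close>

lemma kernel_function_mem:
  assumes "w \<in> ball 0 R"
  shows "kernel_function w \<in> H" "taylor_coeff (kernel_function w) n = cnj w ^ n / of_real (W n)"
proof -
  obtain f where f: "f \<in> H" "\<And>n. taylor_coeff f n = cnj w ^ n / of_real (W n)"
    using exists_with_coeffs[OF kernel_coeffs_summable[OF assms]] by blast
  have "f = kernel_function w"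
  proof
    fix z
    show "f z = kernel_function w z"
    proof (cases "z \<in> ball 0 R")
      case True
      then have "(\<lambda>n. cnj w ^ n / of_real (W n) * z ^ n) sums f z"
        using taylor_sums[OF in_Hol[OF f(1)] True] f(2) by simp
      then show ?thesis using True
        by (simp add: kernel_function_def sums_iff power_mult_distrib mult.commute)
    next
      case False
      then show ?thesis using in_Hol[OF f(1)] by (auto simp: kernel_function_def Hol_def)
    qed
  qed
  with f show "kernel_function w \<in> H" "taylor_coeff (kernel_function w) n = cnj w ^ n / of_real (W n)"
    by auto
qed

lemma reproducing:
  assumes "f \<in> H" "w \<in> ball 0 R"
  shows "f w = ip f (kernel_function w)"
proof -
  have eq: "of_real (W n) * (taylor_coeff f n * cnj (taylor_coeff (kernel_function w) n)) = taylor_coeff f n * w ^ n" for n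
    using W_pos[of n] by (simp add: kernel_function_mem(2)[OF assms(2)])
  show ?thesis
    using taylor_sums[OF in_Hol[OF assms(1)] assms(2)] ip_sums[OF assms(1) kernel_function_mem(1)[OF assms(2)]]
    unfolding eq by (rule sums_unique2)
qed

lemma reproducing_kernelI:
  assumes "\<And>z w. z \<in> ball 0 R \<Longrightarrow> w \<in> ball 0 R \<Longrightarrow> (\<lambda>n. (z * cnj w) ^ n / of_real (W n)) sums K z w"
  shows "reproducing_kernel (ball 0 R) H ip K"
proof -
  have "restrict_zero (ball 0 R) (\<lambda>z. K z w) = kernel_function w" if "w \<in> ball 0 R" for w
    using assms[OF _ that] by (auto simp: restrict_zero_def kernel_function_def sums_iff)
  then show ?thesis
    by (auto simp: reproducing_kernel_def kernel_function_mem reproducing simp del: mem_ball)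
qed

text \<open>Cauchy-Schwarz is applied to finite sums, after splitting each term with the factor
  \<open>sqrt (W n)\<close>, and the limit is taken last. The constant is the square root of the
  kernel on the diagonal.\<close>

lemma evaluation_le:
  assumes f: "f \<in> H" and w: "w \<in> ball 0 R"
  shows "cmod (f w) \<le> sqrt (\<Sum>n. ((cmod w)\<^sup>2) ^ n / W n) * sqrt (Re (ip f f))"
proof -
  let ?a = "taylor_coeff f" and ?k = "\<Sum>n. ((cmod w)\<^sup>2) ^ n / W n"
  have w2: "(cmod w)\<^sup>2 < R\<^sup>2" using w R_pos by (intro power_strict_mono) auto
  have le: "cmod (\<Sum>n<N. ?a n * w ^ n) \<le> sqrt (?k * Re (ip f f))" for N
  proof (rule real_le_rsqrt)
    have "(cmod (\<Sum>n<N. ?a n * w ^ n))\<^sup>2 \<le> (\<Sum>n<N. (cmod w ^ n / sqrt (W n)) * (sqrt (W n) * cmod (?a n)))\<^sup>2"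
    proof (intro power_mono order_trans[OF norm_sum] sum_mono)
      show "cmod (?a n * w ^ n) \<le> (cmod w ^ n / sqrt (W n)) * (sqrt (W n) * cmod (?a n))" for n
        using W_pos[of n] by (simp add: norm_mult norm_power)
    qed simp
    also have "\<dots> \<le> (\<Sum>n<N. (cmod w ^ n / sqrt (W n))\<^sup>2) * (\<Sum>n<N. (sqrt (W n) * cmod (?a n))\<^sup>2)"
      by (rule Cauchy_Schwarz_ineq_sum)
    also have "\<dots> = (\<Sum>n<N. ((cmod w)\<^sup>2) ^ n / W n) * (\<Sum>n<N. W n * (cmod (?a n))\<^sup>2)"
      using W_pos by (simp add: power_divide power_mult_distrib less_imp_le mult.commute flip: power_mult)
    also have "\<dots> \<le> ?k * Re (ip f f)"
      using W_pos by (intro mult_mono partial_sum_le[OF f] sum_le_suminf suminf_nonneg summable_inverse_weights w2 sum_nonneg)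
        (auto simp: less_imp_le)
    finally show "(cmod (\<Sum>n<N. ?a n * w ^ n))\<^sup>2 \<le> ?k * Re (ip f f)" .
  qed
  have "(\<lambda>N. cmod (\<Sum>n<N. ?a n * w ^ n)) \<longlonglongrightarrow> cmod (f w)"
    using taylor_sums[OF in_Hol[OF f] w] unfolding sums_def by (rule tendsto_norm)
  then have "cmod (f w) \<le> sqrt (?k * Re (ip f f))"
    by (rule LIMSEQ_le_const2) (use le in auto)
  then show ?thesis by (simp add: real_sqrt_mult)
qed

text \<open>The limit is built coefficient by coefficient. All estimates are kept on finite sums
  over \<open>n < K\<close>, uniformly in \<open>K\<close>, so that the limit in \<open>j\<close> is
  one of a finite sum; \<open>K\<close> tends to infinity only at the end.\<close>

lemma complete_space:
  assumes F: "\<And>n. F n \<in> H"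
    and cauchy: "\<And>e. e > 0 \<Longrightarrow> \<exists>N. \<forall>i\<ge>N. \<forall>j\<ge>N.
          sqrt (Re (ip (\<lambda>x. F i x - F j x) (\<lambda>x. F i x - F j x))) < e"
  shows "\<exists>f\<in>H. (\<lambda>n. sqrt (Re (ip (\<lambda>x. F n x - f x) (\<lambda>x. F n x - f x)))) \<longlonglongrightarrow> 0"
proof -
  let ?a = "\<lambda>i n. taylor_coeff (F i) n"
  have Hol: "F n \<in> Hol R" for n using F by (rule in_Hol)
  have coeff_diff: "taylor_coeff (\<lambda>x. F i x - F j x) n = ?a i n - ?a j n" for i j n
    using R_pos Hol by (intro taylor_coeff_diff)
  have small: "\<exists>N. \<forall>i\<ge>N. \<forall>j\<ge>N. \<forall>K. (\<Sum>n<K. W n * (cmod (?a i n - ?a j n))\<^sup>2) \<le> e\<^sup>2" if "e > 0" for e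
  proof -
    obtain N where N: "\<And>i j. i \<ge> N \<Longrightarrow> j \<ge> N \<Longrightarrow> sqrt (Re (ip (\<lambda>x. F i x - F j x) (\<lambda>x. F i x - F j x))) < e"
      using cauchy[OF \<open>e > 0\<close>] by blast
    have "(\<Sum>n<K. W n * (cmod (?a i n - ?a j n))\<^sup>2) \<le> e\<^sup>2" if "i \<ge> N" "j \<ge> N" for i j K
      using partial_sum_le[OF diff_in[OF F F], of i j K] sqrt_le_D[OF less_imp_le[OF N[OF that]]]
      by (simp add: coeff_diff)
    then show ?thesis by blast
  qed
  have "Cauchy (\<lambda>i. ?a i n)" for n
  proof (rule metric_CauchyI)
    fix e :: real assume "e > 0"
    \<comment> \<open>Dividing by \<open>W n\<close> then leaves the bound \<open>e / 2\<close>; the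
      half makes the final inequality strict.\<close>
    define d where "d = e / 2 * sqrt (W n)"
    have "d > 0" using \<open>e > 0\<close> W_pos by (simp add: d_def)
    then obtain N where N: "\<And>i j K. i \<ge> N \<Longrightarrow> j \<ge> N \<Longrightarrow> (\<Sum>n<K. W n * (cmod (?a i n - ?a j n))\<^sup>2) \<le> d\<^sup>2"
      using small by blast
    have "dist (?a i n) (?a j n) < e" if "i \<ge> N" "j \<ge> N" for i j
    proof -
      have "W n * (cmod (?a i n - ?a j n))\<^sup>2 \<le> (\<Sum>n<Suc n. W n * (cmod (?a i n - ?a j n))\<^sup>2)"
        using W_pos by (intro member_le_sum) (auto simp: less_imp_le)
      also have "\<dots> \<le> d\<^sup>2" using N[OF that] .
      also have "d\<^sup>2 = W n * (e / 2)\<^sup>2" using W_pos[of n] by (simp add: d_def power_mult_distrib power_divide less_imp_le)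
      finally have "(cmod (?a i n - ?a j n))\<^sup>2 \<le> (e / 2)\<^sup>2" using W_pos[of n] by simp
      then have "cmod (?a i n - ?a j n) \<le> e / 2"
        by (rule power2_le_imp_le) (use \<open>e > 0\<close> in simp)
      then show ?thesis using \<open>e > 0\<close> by (simp add: dist_norm)
    qed
    then show "\<exists>M. \<forall>m\<ge>M. \<forall>k\<ge>M. dist (?a m n) (?a k n) < e" by blast
  qed
  then have "\<forall>n. \<exists>l. (\<lambda>i. ?a i n) \<longlonglongrightarrow> l"
    by (simp add: Cauchy_convergent_iff convergent_def)
  then obtain a where a: "\<And>n. (\<lambda>i. ?a i n) \<longlonglongrightarrow> a n" by metis
  have near: "\<exists>N. \<forall>i\<ge>N. \<forall>K. (\<Sum>n<K. W n * (cmod (?a i n - a n))\<^sup>2) \<le> e\<^sup>2" if "e > 0" for e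
  proof -
    obtain N where N: "\<And>i j K. i \<ge> N \<Longrightarrow> j \<ge> N \<Longrightarrow> (\<Sum>n<K. W n * (cmod (?a i n - ?a j n))\<^sup>2) \<le> e\<^sup>2"
      using small[OF \<open>e > 0\<close>] by blast
    have "(\<Sum>n<K. W n * (cmod (?a i n - a n))\<^sup>2) \<le> e\<^sup>2" if "i \<ge> N" for i K
    proof (rule LIMSEQ_le_const2)
      show "(\<lambda>j. \<Sum>n<K. W n * (cmod (?a i n - ?a j n))\<^sup>2) \<longlonglongrightarrow> (\<Sum>n<K. W n * (cmod (?a i n - a n))\<^sup>2)"
        by (intro tendsto_intros a)
      show "\<exists>N. \<forall>j\<ge>N. (\<Sum>n<K. W n * (cmod (?a i n - ?a j n))\<^sup>2) \<le> e\<^sup>2"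
        using N[OF that] by blast
    qed
    then show ?thesis by blast
  qed
  have sm: "summable (\<lambda>n. W n * (cmod (a n))\<^sup>2)"
  proof -
    obtain i where i: "\<And>K. (\<Sum>n<K. W n * (cmod (?a i n - a n))\<^sup>2) \<le> 1\<^sup>2"
      using near[of 1] by auto
    \<comment> \<open>\<open>a n\<close> is recovered as
      \<open>-1 * (?a i n - a n) + ?a i n\<close>, so that the closure lemmas for multiples and sums
      apply.\<close>
    have "summable (\<lambda>n. W n * (cmod (-1 * (?a i n - a n)))\<^sup>2)"
      using i W_pos by (intro summable_weighted_scale summableI_nonneg_bounded[where x = "1\<^sup>2"]) (auto simp: less_imp_le)
    moreover have "summable (\<lambda>n. W n * (cmod (?a i n))\<^sup>2)" using F by (simp add: mem_iff)
    ultimately have "summable (\<lambda>n. W n * (cmod (-1 * (?a i n - a n) + ?a i n))\<^sup>2)"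
      using W_pos by (intro summable_weighted_add) (auto simp: less_imp_le)
    then show ?thesis by simp
  qed
  obtain f where f: "f \<in> H" "\<And>n. taylor_coeff f n = a n"
    using exists_with_coeffs[OF sm] by blast
  have "(\<lambda>n. sqrt (Re (ip (\<lambda>x. F n x - f x) (\<lambda>x. F n x - f x)))) \<longlonglongrightarrow> 0"
  proof (rule metric_LIMSEQ_I)
    fix e :: real assume "e > 0"
    then obtain N where N: "\<And>i K. i \<ge> N \<Longrightarrow> (\<Sum>n<K. W n * (cmod (?a i n - a n))\<^sup>2) \<le> (e / 2)\<^sup>2"
      using near[of "e / 2"] by auto
    have "dist (sqrt (Re (ip (\<lambda>x. F i x - f x) (\<lambda>x. F i x - f x)))) 0 < e" if "i \<ge> N" for i
    proof -
      have d: "(\<lambda>x. F i x - f x) \<in> H" using F f by (intro diff_in)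
      have "taylor_coeff (\<lambda>x. F i x - f x) n = ?a i n - a n" for n
        using R_pos Hol in_Hol[OF f(1)] f(2) by (subst taylor_coeff_diff) auto
      then have "(\<lambda>K. \<Sum>n<K. W n * (cmod (?a i n - a n))\<^sup>2) \<longlonglongrightarrow> Re (ip (\<lambda>x. F i x - f x) (\<lambda>x. F i x - f x))"
        using ip_self(1)[OF d] by (simp add: sums_def)
      then have "Re (ip (\<lambda>x. F i x - f x) (\<lambda>x. F i x - f x)) \<le> (e / 2)\<^sup>2"
        by (rule LIMSEQ_le_const2) (use N[OF that] in auto)
      then have "sqrt (Re (ip (\<lambda>x. F i x - f x) (\<lambda>x. F i x - f x))) \<le> e / 2"
        using \<open>e > 0\<close> by (intro real_le_lsqrt) auto
      then show ?thesis using \<open>e > 0\<close> ip_self_nonneg[OF d] by simp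
    qed
    then show "\<exists>N. \<forall>i\<ge>N. dist (sqrt (Re (ip (\<lambda>x. F i x - f x) (\<lambda>x. F i x - f x)))) 0 < e" by blast
  qed
  with f(1) show ?thesis by blast
qed

sublocale reproducing_kernel_hilbert_space "ball 0 R" H ip
proof
  show "f x = 0" if "f \<in> H" "x \<notin> ball 0 R" for f x
    using that by (auto simp: mem_iff Hol_def)
  have z: "(\<lambda>x. 0) \<in> Hol R" by (auto simp: Hol_def)
  have "taylor_coeff (\<lambda>x. 0) n = 0" for n
    using taylor_coeff_scale[OF R_pos z, of 0 n] by simp
  then show "(\<lambda>x. 0) \<in> H" using z by (simp add: mem_iff)
  show "(\<lambda>x. f x + g x) \<in> H" if "f \<in> H" "g \<in> H" for f g using that by (rule add_in)
  show "(\<lambda>x. c * f x) \<in> H" if "f \<in> H" for f c using that by (rule scale_in)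
  show "ip (\<lambda>x. f x + g x) h = ip f h + ip g h" if "f \<in> H" "g \<in> H" "h \<in> H" for f g h
    using ip_sums[OF add_in[OF that(1,2)] that(3)] sums_add[OF ip_sums[OF that(1,3)] ip_sums[OF that(2,3)]]
    by (simp add: taylor_coeff_add[OF R_pos] in_Hol that algebra_simps sums_unique2)
  show "ip (\<lambda>x. c * f x) g = c * ip f g" if "f \<in> H" "g \<in> H" for f g c
  proof (rule sums_unique2)
    show "(\<lambda>n. c * (of_real (W n) * (taylor_coeff f n * cnj (taylor_coeff g n)))) sums ip (\<lambda>x. c * f x) g"
      using ip_sums[OF scale_in[OF that(1)] that(2), of c]
      by (simp add: taylor_coeff_scale[OF R_pos in_Hol[OF that(1)]] mult_ac)
    show "(\<lambda>n. c * (of_real (W n) * (taylor_coeff f n * cnj (taylor_coeff g n)))) sums (c * ip f g)"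
      by (intro sums_mult ip_sums that)
  qed
  show "ip g f = cnj (ip f g)" if "f \<in> H" "g \<in> H" for f g
    using ip_sums[OF that(2,1)] sums_cnj[THEN iffD2, OF ip_sums[OF that]]
    by (simp add: mult_ac sums_unique2)
  show "ip f f \<in> \<real> \<and> 0 \<le> Re (ip f f)" if "f \<in> H" for f
    using ip_self(2) ip_self_nonneg that by blast
  show "f = (\<lambda>x. 0)" if "f \<in> H" "ip f f = 0" for f
  proof (rule Hol_eqI[OF in_Hol[OF that(1)] z])
    fix n
    have "W n * (cmod (taylor_coeff f n))\<^sup>2 \<le> (\<Sum>n<Suc n. W n * (cmod (taylor_coeff f n))\<^sup>2)"
      using W_pos by (intro member_le_sum) (auto simp: less_imp_le)
    also have "\<dots> \<le> 0" using partial_sum_le[OF that(1), of "Suc n"] that(2) by simp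
    finally show "taylor_coeff f n = taylor_coeff (\<lambda>x. 0) n"
      using W_pos[of n] \<open>\<And>n. taylor_coeff (\<lambda>x. 0) n = 0\<close> by (simp add: mult_le_0_iff)
  qed
  show "\<exists>C. \<forall>f\<in>H. cmod (f x) \<le> C * sqrt (Re (ip f f))" if "x \<in> ball 0 R" for x
    using evaluation_le that by blast
qed (rule complete_space)

end

section \<open>The Bergman-type spaces\<close>

text \<open>Padding with zeros turns the polynomial into a power series, so the formulas for power
  series cover both parts.\<close>

lemma part1_sums: "(\<lambda>k. (if k < m then taylor_coeff f k else 0) * z ^ k) sums part1 m f z"
proof -
  have "(\<lambda>k. if k \<in> {..<m} then taylor_coeff f k * z ^ k else 0) sums (\<Sum>k<m. taylor_coeff f k * z ^ k)"
    by (rule sums_If_finite_set) simp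
  moreover have "(\<lambda>k. if k \<in> {..<m} then taylor_coeff f k * z ^ k else 0) = (\<lambda>k. (if k < m then taylor_coeff f k else 0) * z ^ k)"
    by auto
  ultimately show ?thesis by (simp add: part1_def)
qed

lemma part2_sums:
  assumes "f \<in> Hol R" "z \<in> ball 0 R"
  shows "(\<lambda>n. (if n < m then 0 else taylor_coeff f n) * z ^ n) sums part2 m f z"
proof -
  have "summable (\<lambda>k. taylor_coeff f (k + m) * z ^ (k + m))"
    using sums_summable[OF taylor_sums[OF assms]] by (subst summable_iff_shift)
  then have "(\<lambda>k. taylor_coeff f (k + m) * z ^ (k + m)) sums part2 m f z"
    by (simp add: part2_def summable_sums)
  then have "(\<lambda>k. (if k + m < m then 0 else taylor_coeff f (k + m)) * z ^ (k + m)) sums part2 m f z"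
    by simp
  then show ?thesis by (subst (asm) sums_iff_shift) simp
qed

text \<open>Instead of differentiating the series m times, the coefficients are read off at 0: the
  k-th derivative of the m-th derivative there is the (k + m)-th derivative of
  \<open>part2 m f\<close>.\<close>

lemma higher_deriv_part2_sums:
  assumes "f \<in> Hol R" "0 < R" "z \<in> ball 0 R"
  shows "(\<lambda>k. (fact (k + m) / fact k * taylor_coeff f (k + m)) * z ^ k) sums (deriv ^^ m) (part2 m f) z"
proof -
  let ?p = "part2 m f"
  have "?p holomorphic_on ball 0 R"
    using part2_sums[OF assms(1), of _ m]
    by (intro power_series_holomorphic[of 0 R "\<lambda>n. if n < m then 0 else taylor_coeff f n"]) auto
  then have "(deriv ^^ m) ?p holomorphic_on ball 0 R"
    by (intro holomorphic_higher_deriv) auto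
  then have "(\<lambda>k. taylor_coeff ((deriv ^^ m) ?p) k * z ^ k) sums (deriv ^^ m) ?p z"
    using assms(3) by (rule taylor_sums_holomorphic)
  moreover have "taylor_coeff ((deriv ^^ m) ?p) k = fact (k + m) / fact k * taylor_coeff f (k + m)" for k
  proof -
    have "taylor_coeff ?p (k + m) = taylor_coeff f (k + m)"
      using taylor_coeff_eqI[OF assms(2) part2_sums[OF assms(1)], of m "k + m"] by simp
    moreover have "(deriv ^^ k) ((deriv ^^ m) ?p) 0 = fact (k + m) * taylor_coeff ?p (k + m)"
      by (simp add: fps_expansion_def funpow_add)
    ultimately show ?thesis by (simp add: fps_expansion_def)
  qed
  ultimately show ?thesis by simp
qed

text \<open>For \<alpha> > -1: below m the squared norm of z^n, from m on that of its m-th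
  derivative, which is n! / (n - m)! times z^(n - m).\<close>

definition bergman_weight :: "real \<Rightarrow> real \<Rightarrow> nat \<Rightarrow> nat \<Rightarrow> real" where
  "bergman_weight R \<alpha> m n =
    (if n < m then disc_moment R \<alpha> n else (fact n / fact (n - m))\<^sup>2 * disc_moment R \<alpha> (n - m))"

lemma bergman_weight_pos: "0 < R \<Longrightarrow> -1 < \<alpha> \<Longrightarrow> 0 < bergman_weight R \<alpha> m n"
  by (simp add: bergman_weight_def disc_moment_pos)

lemma bergman_weight_less: "n < m \<Longrightarrow> bergman_weight R \<alpha> m n = disc_moment R \<alpha> n"
  and bergman_weight_add: "bergman_weight R \<alpha> m (k + m) = (fact (k + m) / fact k)\<^sup>2 * disc_moment R \<alpha> k"
  by (simp_all add: bergman_weight_def)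

lemma bergman_norm2_Hol:
  assumes "0 < R" "-1 < \<alpha>" "f \<in> Hol R"
  shows "bergman_norm2 R \<alpha> m f = (\<Sum>n<m. ennreal (bergman_weight R \<alpha> m n * (cmod (taylor_coeff f n))\<^sup>2))
    + (\<Sum>k. ennreal (bergman_weight R \<alpha> m (k + m) * (cmod (taylor_coeff f (k + m)))\<^sup>2))"
proof -
  have "disc_norm2 R \<alpha> (part1 m f) = (\<Sum>k. ennreal (disc_moment R \<alpha> k * (cmod (if k < m then taylor_coeff f k else 0))\<^sup>2))"
    by (rule disc_norm2_coeffs[OF assms(1,2) part1_sums])
  also have "\<dots> = (\<Sum>n<m. ennreal (bergman_weight R \<alpha> m n * (cmod (taylor_coeff f n))\<^sup>2))"
    by (subst suminf_finite[of "{..<m}"]) (auto simp: bergman_weight_less)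
  finally have 1: "disc_norm2 R \<alpha> (part1 m f) = \<dots>" .
  have "disc_norm2 R \<alpha> ((deriv ^^ m) (part2 m f))
     = (\<Sum>k. ennreal (disc_moment R \<alpha> k * (cmod (fact (k + m) / fact k * taylor_coeff f (k + m)))\<^sup>2))"
    by (rule disc_norm2_coeffs[OF assms(1,2) higher_deriv_part2_sums[OF assms(3,1)]])
  also have "\<dots> = (\<Sum>k. ennreal (bergman_weight R \<alpha> m (k + m) * (cmod (taylor_coeff f (k + m)))\<^sup>2))"
    by (simp add: bergman_weight_add norm_mult norm_divide power_mult_distrib power_divide mult_ac)
  finally show ?thesis using 1 by (simp add: bergman_norm2_def)
qed

lemma mem_bergman_space_iff:
  assumes R: "0 < R" "-1 < \<alpha>"
  shows "f \<in> bergman_space R \<alpha> m \<longleftrightarrow>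
    f \<in> Hol R \<and> summable (\<lambda>n. bergman_weight R \<alpha> m n * (cmod (taylor_coeff f n))\<^sup>2)"
proof (cases "f \<in> Hol R")
  case True
  let ?g = "\<lambda>n. bergman_weight R \<alpha> m n * (cmod (taylor_coeff f n))\<^sup>2"
  have nonneg: "0 \<le> ?g n" for n using bergman_weight_pos[OF R, of m n] by simp
  \<comment> \<open>The terms below m form a finite sum of finite values, so only the tail
    decides.\<close>
  have "bergman_norm2 R \<alpha> m f < \<infinity> \<longleftrightarrow> (\<Sum>k. ennreal (?g (k + m))) \<noteq> top"
    by (simp add: bergman_norm2_Hol[OF R True] less_top)
  also have "\<dots> \<longleftrightarrow> summable (\<lambda>k. ?g (k + m))"
    by (rule iffI) (rule summable_suminf_not_top[OF nonneg] ennreal_suminf_neq_top[OF _ nonneg], assumption)+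
  also have "\<dots> \<longleftrightarrow> summable ?g" by (rule summable_iff_shift)
  finally show ?thesis using True by (simp add: bergman_space_def)
qed (simp add: bergman_space_def)

lemma bergman_ip_sums:
  assumes R: "0 < R" "-1 < \<alpha>" and f: "f \<in> bergman_space R \<alpha> m" and g: "g \<in> bergman_space R \<alpha> m"
  shows "(\<lambda>n. of_real (bergman_weight R \<alpha> m n) * (taylor_coeff f n * cnj (taylor_coeff g n))) sums bergman_ip R \<alpha> m f g"
    (is "?F sums _")
proof -
  let ?m = "disc_moment R \<alpha>"
  have sm1: "summable (\<lambda>k. ?m k * (cmod (if k < m then taylor_coeff h k else 0))\<^sup>2)" for h
    by (rule summable_finite[of "{..<m}"]) auto
  have "(\<lambda>k. of_real (?m k) * ((if k < m then taylor_coeff f k else 0) * cnj (if k < m then taylor_coeff g k else 0)))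
      sums disc_ip R \<alpha> (part1 m f) (part1 m g)"
    by (rule disc_ip_sums[OF R part1_sums part1_sums sm1 sm1])
  moreover have "(\<lambda>k. of_real (?m k) * ((if k < m then taylor_coeff f k else 0) * cnj (if k < m then taylor_coeff g k else 0)))
      = (\<lambda>k. if k \<in> {..<m} then ?F k else 0)"
    by (auto simp: bergman_weight_less)
  ultimately have 1: "disc_ip R \<alpha> (part1 m f) (part1 m g) = (\<Sum>k<m. ?F k)"
    using sums_If_finite_set[of "{..<m}" ?F] by (simp add: sums_unique2)
  have "(\<lambda>k. of_real (?m k) * ((fact (k + m) / fact k * taylor_coeff f (k + m)) * cnj (fact (k + m) / fact k * taylor_coeff g (k + m))))
      sums disc_ip R \<alpha> ((deriv ^^ m) (part2 m f)) ((deriv ^^ m) (part2 m g))"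
  proof (rule disc_ip_sums[OF R higher_deriv_part2_sums higher_deriv_part2_sums])
    have "summable (\<lambda>k. ?m k * (cmod (fact (k + m) / fact k * taylor_coeff h (k + m)))\<^sup>2)" if "h \<in> bergman_space R \<alpha> m" for h
    proof -
      have "summable (\<lambda>k. bergman_weight R \<alpha> m (k + m) * (cmod (taylor_coeff h (k + m)))\<^sup>2)"
        using that unfolding mem_bergman_space_iff[OF R] by (subst summable_iff_shift) simp
      then show ?thesis
        by (simp add: bergman_weight_add norm_mult norm_divide power_mult_distrib power_divide mult_ac)
    qed
    then show "summable (\<lambda>k. ?m k * (cmod (fact (k + m) / fact k * taylor_coeff f (k + m)))\<^sup>2)"
      "summable (\<lambda>k. ?m k * (cmod (fact (k + m) / fact k * taylor_coeff g (k + m)))\<^sup>2)"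
      using f g by blast+
  qed (use R f g in \<open>auto simp: bergman_space_def\<close>)
  then have "(\<lambda>k. ?F (k + m)) sums disc_ip R \<alpha> ((deriv ^^ m) (part2 m f)) ((deriv ^^ m) (part2 m g))"
    by (simp add: bergman_weight_add power2_eq_square mult_ac)
  then have "?F sums (disc_ip R \<alpha> ((deriv ^^ m) (part2 m f)) ((deriv ^^ m) (part2 m g)) + (\<Sum>k<m. ?F k))"
    by (subst (asm) sums_iff_shift)
  then show ?thesis by (simp add: bergman_ip_def 1 add.commute)
qed

section \<open>Growth of the weights\<close>

lemma bergman_weight_Suc:
  assumes "0 < R" "-1 < \<alpha>"
  shows "bergman_weight R \<alpha> m (Suc k + m) =
    bergman_weight R \<alpha> m (k + m) * (R\<^sup>2 / ((real k + 1) * (real k + \<alpha> + 2) / (real k + real m + 1)\<^sup>2))"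
proof -
  have "Gamma (real k + \<alpha> + 2 + 1) = (real k + \<alpha> + 2) * Gamma (real k + \<alpha> + 2)"
    using assms by (intro Gamma_plus1) (auto dest: nonpos_Ints_nonpos)
  then have gam: "Gamma (real (Suc k) + \<alpha> + 2) = (real k + \<alpha> + 2) * Gamma (real k + \<alpha> + 2)"
    by (simp add: algebra_simps)
  have fac: "fact (Suc k + m) = (real k + real m + 1) * fact (k + m)" "fact (Suc k) = (real k + 1) * fact k"
    by simp_all
  have pow: "R ^ (2 * Suc k + 2) = R\<^sup>2 * (R\<^sup>2 * R ^ (2 * k))" "R ^ (2 * k + 2) = R\<^sup>2 * R ^ (2 * k)"
    by (simp_all add: power_add power2_eq_square power4_eq_xxxx)
  \<comment> \<open>Letters in place of Gamma values, factorials and powers leave a purely rational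
    identity.\<close>
  have alg: "((u * F) / (p * K))\<^sup>2 * (pi * (p * K * A * (S * (S * P)) / (q * B)))
      = (F / K)\<^sup>2 * (pi * (K * A * (S * P) / B)) * (S / (p * q / u\<^sup>2))"
    if "p \<noteq> 0" "q \<noteq> 0" "u \<noteq> 0" "K \<noteq> 0" "B \<noteq> 0" for A B F K P S p q u :: real
    using that by (simp add: field_simps power2_eq_square)
  have "Gamma (real k + \<alpha> + 2) \<noteq> 0"
    using Gamma_real_pos[of "real k + \<alpha> + 2"] assms by linarith
  then show ?thesis
    unfolding bergman_weight_add disc_moment_def gam fac pow using assms by (intro alg) auto
qed

text \<open>By \<open>bergman_weight_Suc\<close>, consecutive terms have ratio x / R^2 times a
  rational function of k that tends to 1 for every \<alpha> and m, so the ratio test applies with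
  limit x / R^2 < 1.\<close>

lemma summable_inverse_bergman_weight:
  assumes R: "0 < R" "-1 < \<alpha>" and x: "0 \<le> x" "x < R\<^sup>2"
  shows "summable (\<lambda>n. x ^ n / bergman_weight R \<alpha> m n)"
proof -
  define \<rho> where "\<rho> k = (real k + 1) * (real k + \<alpha> + 2) / (real k + real m + 1)\<^sup>2" for k
  have "\<rho> \<longlonglongrightarrow> 1" unfolding \<rho>_def by real_asymp
  then have "(\<lambda>k. x / R\<^sup>2 * \<rho> k) \<longlonglongrightarrow> x / R\<^sup>2 * 1" by (intro tendsto_intros)
  moreover have "x / R\<^sup>2 < 1" using x R by simp
  then obtain c where c: "x / R\<^sup>2 < c" "c < 1" using dense by blast
  ultimately have "eventually (\<lambda>k. x / R\<^sup>2 * \<rho> k < c) sequentially" by (intro order_tendstoD(2)) auto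
  then obtain N where N: "\<And>k. k \<ge> N \<Longrightarrow> x / R\<^sup>2 * \<rho> k < c" by (auto simp: eventually_sequentially)
  let ?f = "\<lambda>k. x ^ (k + m) / bergman_weight R \<alpha> m (k + m)"
  have "summable ?f"
  proof (rule summable_ratio_test[OF c(2)])
    fix k assume "k \<ge> N"
    have pos: "0 < bergman_weight R \<alpha> m n" for n by (rule bergman_weight_pos[OF R])
    have "?f (Suc k) = (x / R\<^sup>2 * \<rho> k) * ?f k"
      unfolding bergman_weight_Suc[OF R] by (simp add: \<rho>_def mult_ac)
    also have "\<dots> \<le> c * ?f k"
      using N[OF \<open>k \<ge> N\<close>] pos[of "k + m"] x by (intro mult_right_mono) auto
    finally show "norm (?f (Suc k)) \<le> c * norm (?f k)"
      using pos[of "k + m"] pos[of "Suc k + m"] x by simp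
  qed
  \<comment> \<open>The recurrence concerns indices from m on; the finitely many earlier terms do
    not affect convergence.\<close>
  then show ?thesis by (subst (asm) summable_iff_shift)
qed

lemma weighted_power_series_space_bergman:
  assumes "0 < R" "-1 < \<alpha>"
  shows "weighted_power_series_space R (bergman_weight R \<alpha> m) (bergman_space R \<alpha> m) (bergman_ip R \<alpha> m)"
  using assms by unfold_locales
    (auto intro: bergman_weight_pos summable_inverse_bergman_weight bergman_ip_sums simp: mem_bergman_space_iff)

section \<open>Identification of the kernel\<close>

lemma inverse_bergman_weight_less:
  assumes "0 < R" "-1 < \<alpha>" "n < m"
  shows "1 / bergman_weight R \<alpha> m n =
    (\<alpha> + 1) / (pi * R\<^sup>2) * (Gamma (\<alpha> + 2 + real n) / (Gamma (real n + 1) * Gamma (\<alpha> + 2))) / (R\<^sup>2) ^ n"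
proof -
  \<comment> \<open>Source of the factor \<alpha> + 1 in the kernel: the weight contains
    \<open>Gamma (\<alpha> + 1)\<close>, the kernel formula
    \<open>Gamma (\<alpha> + 2)\<close>.\<close>
  have "Gamma (\<alpha> + 1 + 1) = (\<alpha> + 1) * Gamma (\<alpha> + 1)"
    using assms by (intro Gamma_plus1) (auto dest: nonpos_Ints_nonpos)
  then have gam: "Gamma (\<alpha> + 2) = (\<alpha> + 1) * Gamma (\<alpha> + 1)" "\<alpha> + 2 + real n = real n + \<alpha> + 2"
    by (simp_all add: add.assoc)
  have fac: "Gamma (real n + 1) = fact n" using Gamma_fact[of n, where ?'a = real] by (simp add: add.commute)
  have pow: "R ^ (2 * n + 2) = R\<^sup>2 * (R\<^sup>2) ^ n"
    by (simp add: power_add power_mult power2_eq_square)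
  have alg: "1 / (pi * (K * A * (S * P) / B)) = c / (pi * S) * (B / (K * (c * A))) / P"
    if "c \<noteq> 0" for A B K P S c :: real
    using that by (simp add: field_simps)
  show ?thesis
    unfolding bergman_weight_less[OF assms(3)] disc_moment_def gam fac pow using assms by (intro alg) auto
qed

text \<open>Here the hypergeometric parameters originate. The squared \<open>fact (k + m)\<close> of
  the weight gives the two lower parameters m + 1 and the factor 1 / (m!)^2, and the Gamma quotient
  gives \<alpha> + 2. The upper parameter 1 occurs twice because one
  \<open>pochhammer 1 k = fact k\<close> cancels the k! built into the series and the other
  remains.\<close>

lemma inverse_bergman_weight_add:
  assumes "0 < R" "-1 < \<alpha>"
  shows "1 / bergman_weight R \<alpha> m (k + m) = (\<alpha> + 1) / (pi * R\<^sup>2) * (1 / (fact m)\<^sup>2 *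
    (pochhammer 1 k * pochhammer 1 k * pochhammer (\<alpha> + 2) k
      / (pochhammer (real m + 1) k * pochhammer (real m + 1) k * fact k))) / (R\<^sup>2) ^ k"
proof -
  have "Gamma (\<alpha> + 1 + 1) = (\<alpha> + 1) * Gamma (\<alpha> + 1)"
    using assms by (intro Gamma_plus1) (auto dest: nonpos_Ints_nonpos)
  then have "Gamma (\<alpha> + 2) = (\<alpha> + 1) * Gamma (\<alpha> + 1)" by (simp add: add.assoc)
  moreover have "pochhammer (\<alpha> + 2) k = Gamma (\<alpha> + 2 + real k) / Gamma (\<alpha> + 2)"
    using assms by (intro pochhammer_Gamma) (auto dest: nonpos_Ints_nonpos)
  moreover have "\<alpha> + 2 + real k = real k + \<alpha> + 2" by simp
  ultimately have a: "pochhammer (\<alpha> + 2) k = Gamma (real k + \<alpha> + 2) / ((\<alpha> + 1) * Gamma (\<alpha> + 1))" by simp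
  have "fact (m + k) = (fact m * pochhammer (1 + real m) k :: real)"
    unfolding pochhammer_fact by (rule pochhammer_product')
  then have b: "pochhammer (real m + 1) k = fact (k + m) / fact m" by (simp add: add.commute)
  have pow: "R ^ (2 * k + 2) = R\<^sup>2 * (R\<^sup>2) ^ k"
    by (simp add: power_add power_mult power2_eq_square)
  have alg: "1 / ((F / K)\<^sup>2 * (pi * (K * A * (S * P) / B)))
     = c / (pi * S) * (1 / M\<^sup>2 * (K * K * (B / (c * A)) / (F / M * (F / M) * K))) / P"
    if "c \<noteq> 0" "M \<noteq> 0" "K \<noteq> 0" for A B F K M P S c :: real
    using that by (simp add: field_simps power2_eq_square)
  show ?thesis
    unfolding bergman_weight_add disc_moment_def a b pochhammer_fact[symmetric] pow
    using assms by (intro alg) auto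
qed

lemma bergman_kernel_sums:
  assumes R: "0 < R" "-1 < \<alpha>" and zw: "z \<in> ball 0 R" "w \<in> ball 0 R"
  shows "(\<lambda>n. (z * cnj w) ^ n / of_real (bergman_weight R \<alpha> m n)) sums bergman_kernel R \<alpha> m z w"
proof -
  define x where "x = z * cnj w"
  let ?C = "complex_of_real ((\<alpha> + 1) / (pi * R\<^sup>2))"
  let ?t = "\<lambda>n. x ^ n / complex_of_real (bergman_weight R \<alpha> m n)"
  let ?h = "\<lambda>k. fps_nth (fps_hypergeo [1, 1, complex_of_real \<alpha> + 2] [of_nat m + 1, of_nat m + 1] 1) k"
  have inv: "?t n = x ^ n * complex_of_real (1 / bergman_weight R \<alpha> m n)" for n by simp
  have lo: "?t n = ?C * (of_real (Gamma (\<alpha> + 2 + real n) / (Gamma (real n + 1) * Gamma (\<alpha> + 2))) * (x / of_real (R\<^sup>2)) ^ n)"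
    if "n < m" for n
    unfolding inv inverse_bergman_weight_less[OF R that] by (simp add: power_divide mult_ac)
  have hi: "?t (k + m) = ?C * (x ^ m / (fact m)\<^sup>2 * (?h k * (x / of_real (R\<^sup>2)) ^ k))" for k
  proof -
    have "?h k = complex_of_real (pochhammer 1 k * pochhammer 1 k * pochhammer (\<alpha> + 2) k
      / (pochhammer (real m + 1) k * pochhammer (real m + 1) k * fact k))"
      by (simp flip: pochhammer_of_real add: mult_ac)
    then show ?thesis
      unfolding inv inverse_bergman_weight_add[OF R] by (simp add: power_divide power_add mult_ac)
  qed
  have x: "cmod x < R\<^sup>2"
    using zw R mult_strict_mono[of "cmod z" R "cmod w" R] by (simp add: x_def norm_mult power2_eq_square)
  have "summable (\<lambda>n. norm (?t n))"
    using summable_inverse_bergman_weight[OF R norm_ge_zero x, of m] bergman_weight_pos[OF R, of m]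
    by (simp add: norm_divide norm_power less_imp_le)
  then have "summable (\<lambda>k. ?t (k + m))"
    by (subst summable_iff_shift) (rule summable_norm_cancel)
  then have sm: "summable (\<lambda>k. ?C * (x ^ m / (fact m)\<^sup>2 * (?h k * (x / of_real (R\<^sup>2)) ^ k)))"
    by (simp only: hi)
  have sums: "(\<lambda>k. ?t (k + m)) sums (?C * (x ^ m / (fact m)\<^sup>2 *
    hypergeometric_3F2 1 1 (of_real \<alpha> + 2) (of_nat m + 1) (of_nat m + 1) (x / of_real (R\<^sup>2))))"
  \<comment> \<open>Convergence of the hypergeometric series is inferred from that of the kernel
    tail by cancelling constant factors, which fails when x^m = 0; there all terms and the limit are
    0.\<close>
  proof (cases "x ^ m = 0")
    case True
    then show ?thesis by (simp only: hi) simp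
  next
    case False
    have "?C \<noteq> 0" using R by (simp only: of_real_eq_0_iff) simp
    moreover have "x ^ m / (fact m)\<^sup>2 \<noteq> 0" using False by simp
    ultimately have "summable (\<lambda>k. ?h k * (x / of_real (R\<^sup>2)) ^ k)"
      using sm by (simp only: summable_cmult_iff) simp
    then show ?thesis
      unfolding hi hypergeometric_3F2_def eval_fps_def by (intro sums_mult summable_sums)
  qed
  have "?t sums (?C * (x ^ m / (fact m)\<^sup>2 *
    hypergeometric_3F2 1 1 (of_real \<alpha> + 2) (of_nat m + 1) (of_nat m + 1) (x / of_real (R\<^sup>2))) + (\<Sum>n<m. ?t n))"
    using sums by (subst (asm) sums_iff_shift)
  also have "(\<Sum>n<m. ?t n) = ?C * (\<Sum>n<m. of_real (Gamma (\<alpha> + 2 + real n) / (Gamma (real n + 1) * Gamma (\<alpha> + 2))) * (x / of_real (R\<^sup>2)) ^ n)"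
    unfolding sum_distrib_left by (intro sum.cong refl lo) simp
  finally show ?thesis
    unfolding x_def[symmetric] bergman_kernel_def by (simp only: distrib_left add.commute)
qed

lemma bergman_norm2_eq_coeff_norm2:
  assumes R: "0 < R" "-1 < \<alpha>" and f: "f \<in> Hol R"
  shows "bergman_norm2 R \<alpha> m f = coeff_norm2 R \<alpha> m (taylor_coeff f)"
proof -
  have G: "Gamma (\<alpha> + 1) > 0" "Gamma (real k + \<alpha> + 2) > 0" for k using R by (intro Gamma_real_pos; simp)+
  have eq1: "ennreal pi * ennreal (fact n * Gamma (\<alpha> + 1) * R ^ (2 * n + 2) / Gamma (real n + \<alpha> + 2) * c)
     = ennreal (bergman_weight R \<alpha> m n * c)" if "n < m" for n c
    using that by (simp add: bergman_weight_less disc_moment_def mult_ac flip: ennreal_mult')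
  have eq2: "ennreal pi * ennreal ((fact (k + m))\<^sup>2 * Gamma (\<alpha> + 1) * R ^ (2 * k + 2)
      / (fact k * Gamma (real k + \<alpha> + 2)) * c) = ennreal (bergman_weight R \<alpha> m (k + m) * c)" for k c
  proof -
    have "pi * ((fact (k + m))\<^sup>2 * Gamma (\<alpha> + 1) * R ^ (2 * k + 2) / (fact k * Gamma (real k + \<alpha> + 2)) * c)
      = bergman_weight R \<alpha> m (k + m) * c"
      using G(2)[of k] by (simp add: bergman_weight_add disc_moment_def field_simps power2_eq_square)
    then show ?thesis by (simp flip: ennreal_mult')
  qed
  show ?thesis
    unfolding bergman_norm2_Hol[OF assms] coeff_norm2_def distrib_left sum_distrib_left
      ennreal_suminf_cmult[symmetric] eq2
    by (intro arg_cong2[where f = "(+)"] sum.cong refl) (rule eq1[symmetric], simp)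
qed

section \<open>The degenerate case \<alpha> \<le> -1\<close>

lemma coeffs_zero_of_disc_norm2_finite:
  assumes "0 < R" "\<alpha> \<le> -1" and "\<And>z. z \<in> ball 0 R \<Longrightarrow> (\<lambda>k. b k * z ^ k) sums g z"
    and "disc_norm2 R \<alpha> g < \<infinity>"
  shows "b k = 0"
proof (rule ccontr)
  assume "b k \<noteq> 0"
  \<comment> \<open>The single term of index \<open>k\<close> is already infinite and bounds the
    whole series from below.\<close>
  then have "\<infinity> = (\<Sum>k\<in>{k}. ennreal ((cmod (b k))\<^sup>2) * disc_norm2 R \<alpha> (\<lambda>z. z ^ k))"
    by (simp add: disc_norm2_power_infinite assms(1,2) ennreal_mult_top)
  also have "\<dots> \<le> disc_norm2 R \<alpha> g"
    by (subst disc_norm2_power_series[OF assms(1,3)], assumption) (intro sum_le_suminf, auto)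
  finally show False using assms(4) by simp
qed

lemma bergman_space_trivial:
  assumes "0 < R" "\<alpha> \<le> -1" and f: "f \<in> bergman_space R \<alpha> m" and z: "z \<in> ball 0 R"
  shows "f z = 0"
proof -
  have H: "f \<in> Hol R" and "disc_norm2 R \<alpha> (part1 m f) + disc_norm2 R \<alpha> ((deriv ^^ m) (part2 m f)) < \<infinity>"
    using f by (simp_all add: bergman_space_def bergman_norm2_def)
  then have fin: "disc_norm2 R \<alpha> (part1 m f) < \<infinity>" "disc_norm2 R \<alpha> ((deriv ^^ m) (part2 m f)) < \<infinity>"
    by (simp_all add: less_top)
  have "taylor_coeff f n = 0" for n
  proof (cases "n < m")
    case True
    then show ?thesis
      using coeffs_zero_of_disc_norm2_finite[OF assms(1,2) part1_sums fin(1), of n] by simp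
  next
    \<comment> \<open>The coefficient of index n - m of the derivative is
      \<open>taylor_coeff f n\<close> times the nonzero factor n! / (n - m)!.\<close>
    case False
    then show ?thesis
      using coeffs_zero_of_disc_norm2_finite[OF assms(1,2) higher_deriv_part2_sums[OF H assms(1)] fin(2), of "n - m"]
      by simp
  qed
  then show ?thesis
    using taylor_sums[OF H z] by (simp add: sums_unique2[OF _ sums_zero])
qed

theorem theorem1p1:
  fixes R \<alpha> :: real and m :: nat
  assumes "R > 0"
  shows "((\<exists>f\<in>bergman_space R \<alpha> m. \<exists>z\<in>ball 0 R. f z \<noteq> 0) \<longleftrightarrow> \<alpha> > -1) \<and>
    (\<alpha> > -1 \<longrightarrow>
      reproducing_kernel_hilbert_space (ball 0 R) (bergman_space R \<alpha> m) (bergman_ip R \<alpha> m) \<and>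
      reproducing_kernel (ball 0 R) (bergman_space R \<alpha> m) (bergman_ip R \<alpha> m)
        (bergman_kernel R \<alpha> m) \<and>
      (\<forall>(a :: nat \<Rightarrow> complex) f.
        (\<forall>z\<in>ball 0 R. (\<lambda>n. a n * z ^ n) sums f z) \<and> (\<forall>z. z \<notin> ball 0 R \<longrightarrow> f z = 0) \<longrightarrow>
        bergman_norm2 R \<alpha> m f = coeff_norm2 R \<alpha> m a \<and>
        (f \<in> bergman_space R \<alpha> m \<longleftrightarrow> coeff_norm2 R \<alpha> m a < \<infinity>)))"
proof (cases "\<alpha> > -1")
  case False
  then show ?thesis using bergman_space_trivial[OF assms, of \<alpha> _ m] by auto
next
  case True
  interpret weighted_power_series_space R "bergman_weight R \<alpha> m" "bergman_space R \<alpha> m" "bergman_ip R \<alpha> m"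
    using assms True by (rule weighted_power_series_space_bergman)
  have 0: "0 \<in> ball (0 :: complex) R" using assms by simp
  \<comment> \<open>The nonzero witness is the kernel at 0, which is the constant 1 / W 0 on the
    disc.\<close>
  have "taylor_coeff (kernel_function 0) 0 \<noteq> 0"
    using W_pos[of 0] by (simp add: kernel_function_mem(2)[OF 0])
  then have "kernel_function 0 0 \<noteq> 0"
    by (simp add: fps_expansion_def)
  then have "\<exists>f\<in>bergman_space R \<alpha> m. \<exists>z\<in>ball 0 R. f z \<noteq> 0"
    using kernel_function_mem(1)[OF 0] 0 by blast
  moreover have "reproducing_kernel (ball 0 R) (bergman_space R \<alpha> m) (bergman_ip R \<alpha> m) (bergman_kernel R \<alpha> m)"
    using assms True by (intro reproducing_kernelI bergman_kernel_sums)
  moreover have "bergman_norm2 R \<alpha> m f = coeff_norm2 R \<alpha> m a \<and> (f \<in> bergman_space R \<alpha> m \<longleftrightarrow> coeff_norm2 R \<alpha> m a < \<infinity>)"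
    if "\<forall>z\<in>ball 0 R. (\<lambda>n. a n * z ^ n) sums f z" "\<forall>z. z \<notin> ball 0 R \<longrightarrow> f z = 0" for a f
  proof -
    have H: "f \<in> Hol R" using that by (intro HolI[of R a]) blast+
    have "taylor_coeff f = a" using taylor_coeff_eqI[OF assms, of a f] that by blast
    then have "bergman_norm2 R \<alpha> m f = coeff_norm2 R \<alpha> m a"
      using bergman_norm2_eq_coeff_norm2[OF assms True H] by simp
    then show ?thesis using H by (simp add: bergman_space_def)
  qed
  ultimately show ?thesis using True reproducing_kernel_hilbert_space_axioms by blast
qed

end
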